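(* Let $k$ be an algebraically closed field with a valuation $\nu:k\to\mathbb{T}$, and let $Z\subset\mathbb{P}^n_k$ be an irreducible projective hypersurface that is not contained in any coordinate hyperplane. Then the scheme $\operatorname{Trop}(Z)\subset\mathbb{P}^n_\mathbb{T}$ determines the multiplicities on the facets of the restriction of its $\mathbb{T}$-points to the tropical torus $\mathbb{R}^n$. That is, if $Z=V(f)$ and $Z'=V(g)$ are two such hypersurfaces and $\operatorname{Trop}(Z)=\operatorname{Trop}(Z')$ as closed subschemes of $\mathbb{P}^n_\mathbb{T}$, then the facet multiplicities associated to $f$ and to $g$ on the common polyhedral set $\operatorname{Trop}(Z)(\mathbb{T})\cap\mathbb{R}^n$ coincide.
   Context: $\mathbb{T}=(\mathbb{R}\cup\{-\infty\},\max,+)$ is the tropical semifield, $0_\mathbb{T}=-\infty$, $1_\mathbb{T}=0$. A valuation $\nu:k\to\mathbb{T}$ is a map with $\nu(0)=-\infty$, $\nu(1)=\nu(-1)=0$, $\nu(ab)=\nu(a)+\nu(b)$ (usual addition), $\nu(a+b)\le\max(\nu(a),\nu(b))$. For $h\in\mathbb{T}[x_0,\dots,x_n]$ and a monomial $m\in\operatorname{supp}(h)$, $h_{\widehat m}$ is $h$ with its $m$-term deleted; the bend relations of $h$ are $h\sim h_{\widehat m}$, $m\in\operatorname{supp}(h)$. For a $\mathbb{T}$-submodule $J\subset\mathbb{T}[x_0,\dots,x_n]$, $\mathcal{B}(J)$ is the $\mathbb{T}$-module congruence (equivalence relation that is a submodule of the product) generated by the bend relations of all elements of $J$. For a homogeneous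 ideal $I\subset k[x_0,\dots,x_n]$, $\operatorname{trop}(I)$ is the $\mathbb{T}$-submodule generated by the coefficient-wise valuations $\nu(f)$, $f\in I$; it is an ideal and $\mathcal{B}(\operatorname{trop}(I))$ is a homogeneous semiring congruence. For $Z\subset\mathbb{P}^n_k$ defined by $I$, $\operatorname{Trop}(Z)=\operatorname{Proj}(\mathbb{T}[x_0,\dots,x_n]/\mathcal{B}(\operatorname{trop}(I)))$, a closed subscheme of $\mathbb{P}^n_\mathbb{T}$ (semiring schemes, $\operatorname{Proj}$ and closed subschemes being defined as in ordinary scheme theory, with semiring congruences playing the role of ideals: closed subschemes correspond to quasi-coherent congruence sheaves). The tropical torus $\mathbb{R}^n\cong\mathbb{R}^{n+1}/\mathbb{R}(1,\dots,1)$ is the set of $\mathbb{T}$-points of $\mathbb{P}^n_\mathbb{T}$ with all homogeneous coordinates finite. For $Z=V(f)$ with $f=\sum_u a_ux^u$ homogeneous, the set $\operatorname{Trop}(Z)(\mathbb{T})\cap\mathbb{R}^n$ is the set of $w$ at which $\max_u(\nu(a_u)+u\cdot w)$ is attained at least twice; it is a polyhedral complex of pure dimension $n-1$, whose cells consist of the $w$ with a given set of maximizing exponents. For $w$ in the relative interior of a facet (an $(n-1)$-dimensional cell), the convex hull of the exponents $u$ attaining the maximum is a segment (an edge of the induced subdivision of the Newton polytope of $f$), and the multiplicity of the facet is the lattice length of that segment. *)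

theory Defs
  imports "HOL-Analysis.Analysis" "HOL-Library.Poly_Mapping"
    "HOL-Computational_Algebra.Polynomial"
begin

section \<open>The tropical semifield\<close>

datatype trop = MInf | Fin real

text \<open>
  In the semiring notation of the type classes, \<open>0\<close> is minus infinity, \<open>1\<close> is the real number \<open>0\<close>,
  \<open>+\<close> is the maximum and \<open>*\<close> is the usual addition.
\<close>

instantiation trop :: linorder
begin

fun less_eq_trop :: "trop \<Rightarrow> trop \<Rightarrow> bool" where
  "MInf \<le> y \<longleftrightarrow> True"
| "Fin a \<le> MInf \<longleftrightarrow> False"
| "Fin a \<le> Fin b \<longleftrightarrow> a \<le> b"

definition less_trop :: "trop \<Rightarrow> trop \<Rightarrow> bool" where
  "less_trop x y \<longleftrightarrow> x \<le> y \<and> \<not> y \<le> x"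

instance
proof
  fix x y z :: trop
  show "x < y \<longleftrightarrow> x \<le> y \<and> \<not> y \<le> x" by (fact less_trop_def)
  show "x \<le> x" by (cases x) auto
  show "x \<le> y \<Longrightarrow> y \<le> z \<Longrightarrow> x \<le> z" by (cases x; cases y; cases z) auto
  show "x \<le> y \<Longrightarrow> y \<le> x \<Longrightarrow> x = y" by (cases x; cases y) auto
  show "x \<le> y \<or> y \<le> x" by (cases x; cases y) auto
qed

end

instantiation trop :: "{zero, one, plus, times}"
begin

definition zero_trop :: trop where "0 = MInf"

definition one_trop :: trop where "1 = Fin 0"

definition plus_trop :: "trop \<Rightarrow> trop \<Rightarrow> trop" where "x + y = max x (y::trop)"

fun times_trop :: "trop \<Rightarrow> trop \<Rightarrow> trop" where
  "MInf * y = MInf"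
| "Fin a * MInf = MInf"
| "Fin a * Fin b = Fin (a + b)"

instance ..

end

instance trop :: comm_semiring_1
proof
  fix a b c :: trop
  show "a * b * c = a * (b * c)" by (cases a; cases b; cases c) auto
  show "a * b = b * a" by (cases a; cases b) auto
  show "1 * a = a" by (cases a) (auto simp: one_trop_def)
  show "a + b + c = a + (b + c)" by (simp add: plus_trop_def max.assoc)
  show "a + b = b + a" by (simp add: plus_trop_def max.commute)
  show "0 + a = a" by (simp add: plus_trop_def zero_trop_def max_def)
  show "0 * a = 0" "a * 0 = 0" by (cases a; simp add: zero_trop_def)+
  show "(a + b) * c = a * c + b * c"
    by (cases a; cases b; cases c) (auto simp: plus_trop_def max_def)
  show "(0::trop) \<noteq> 1" by (simp add: zero_trop_def one_trop_def)
qed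

definition valuation :: "('k::field \<Rightarrow> trop) \<Rightarrow> bool" where
  "valuation \<nu> \<longleftrightarrow> \<nu> 0 = 0 \<and> \<nu> 1 = 1 \<and> \<nu> (- 1) = 1 \<and>
     (\<forall>a b. \<nu> (a * b) = \<nu> a * \<nu> b) \<and> (\<forall>a b. \<nu> (a + b) \<le> max (\<nu> a) (\<nu> b))"


section \<open>Polynomials\<close>

text \<open>
  The variables are indexed by a finite type \<open>'n\<close>, which stands for \<open>{0,\<dots>,n}\<close>; thus
  \<open>CARD('n) = n + 1\<close>.
\<close>

type_synonym ('n, 'a) mpoly = "('n \<Rightarrow>\<^sub>0 nat) \<Rightarrow>\<^sub>0 'a"

definition var :: "'n \<Rightarrow> ('n, 'a::comm_semiring_1) mpoly" where
  "var i = Poly_Mapping.single (Poly_Mapping.single i 1) 1"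

definition cmult :: "'a \<Rightarrow> ('n, 'a) mpoly \<Rightarrow> ('n, 'a::comm_semiring_1) mpoly" where
  "cmult c h = Poly_Mapping.single 0 c * h"

definition exp_degree :: "('n::finite \<Rightarrow>\<^sub>0 nat) \<Rightarrow> nat" where
  "exp_degree u = (\<Sum>i\<in>UNIV. Poly_Mapping.lookup u i)"

definition homogeneous :: "nat \<Rightarrow> ('n::finite, 'a::comm_semiring_1) mpoly \<Rightarrow> bool" where
  "homogeneous d h \<longleftrightarrow> (\<forall>u\<in>Poly_Mapping.keys h. exp_degree u = d)"

definition homogeneous_elements :: "('n::finite, 'a::comm_semiring_1) mpoly set" where
  "homogeneous_elements = {h. \<exists>d. homogeneous d h}"

definition hom_component ::
    "nat \<Rightarrow> ('n::finite, 'a) mpoly \<Rightarrow> ('n, 'a::comm_semiring_1) mpoly" where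
  "hom_component d h = Poly_Mapping.mapp (\<lambda>u c. c when exp_degree u = d) h"

lemma homogeneous_mult:
  assumes "homogeneous d a" "homogeneous e b"
  shows "homogeneous (d + e) (a * b)"
  unfolding homogeneous_def
proof
  fix u assume "u \<in> Poly_Mapping.keys (a * b)"
  then obtain v w where "u = v + w" "v \<in> Poly_Mapping.keys a" "w \<in> Poly_Mapping.keys b"
    using keys_mult[of a b] by blast
  with assms show "exp_degree u = d + e"
    by (simp add: homogeneous_def exp_degree_def lookup_add sum.distrib)
qed


section \<open>Projective space over a semiring\<close>

text \<open>
  Everything here is for the graded semiring \<open>S = A[x\<^sub>0,\<dots>,x\<^sub>n]\<close>, where \<open>A\<close> is a field or the tropical
  semifield. Primality of a homogeneous ideal is tested on homogeneous elements. For rings this is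
  equivalent to being a prime ideal; for semirings it is the condition under which the distinguished
  open of \<open>x\<^sub>i\<close> is the prime spectrum of \<open>A[x\<^sub>0/x\<^sub>i,\<dots>,x\<^sub>n/x\<^sub>i]\<close>.
\<close>

definition semiring_ideal :: "'a::comm_semiring_1 set \<Rightarrow> bool" where
  "semiring_ideal p \<longleftrightarrow> 0 \<in> p \<and> (\<forall>a\<in>p. \<forall>b\<in>p. a + b \<in> p) \<and> (\<forall>a\<in>p. \<forall>c. c * a \<in> p)"

definition homogeneous_ideal :: "('n::finite, 'a::comm_semiring_1) mpoly set \<Rightarrow> bool" where
  "homogeneous_ideal p \<longleftrightarrow> semiring_ideal p \<and> (\<forall>h\<in>p. \<forall>d. hom_component d h \<in> p)"

definition homogeneous_prime :: "('n::finite, 'a::comm_semiring_1) mpoly set \<Rightarrow> bool" where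
  "homogeneous_prime p \<longleftrightarrow> homogeneous_ideal p \<and> 1 \<notin> p \<and>
     (\<forall>a\<in>homogeneous_elements. \<forall>b\<in>homogeneous_elements. a * b \<in> p \<longrightarrow> a \<in> p \<or> b \<in> p)"

definition irrelevant_ideal :: "('n::finite, 'a::comm_semiring_1) mpoly set" where
  "irrelevant_ideal = {h. Poly_Mapping.lookup h 0 = 0}"

definition Proj :: "('n::finite, 'a::comm_semiring_1) mpoly set set" where
  "Proj = {p. homogeneous_prime p \<and> \<not> irrelevant_ideal \<subseteq> p}"

definition zeros :: "('n::finite, 'a::comm_semiring_1) mpoly set \<Rightarrow> ('n, 'a) mpoly set set" where
  "zeros E = {p \<in> Proj. E \<subseteq> p}"

definition zariski :: "('n::finite, 'a::comm_semiring_1) mpoly set topology" where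
  "zariski = topology (\<lambda>U. \<exists>E \<subseteq> homogeneous_elements. U = Proj - zeros E)"

lemma openin_zariski:
  "openin zariski U \<longleftrightarrow> (\<exists>E \<subseteq> homogeneous_elements. U = Proj - zeros E)"
proof -
  let ?L = "\<lambda>U::('a, 'b) mpoly set set. \<exists>E \<subseteq> homogeneous_elements. U = Proj - zeros E"
  have "istopology ?L"
    unfolding istopology_def
  proof (intro conjI allI impI)
    fix S T assume "?L S" "?L T"
    then obtain E F where EF: "E \<subseteq> homogeneous_elements" "S = Proj - zeros E"
      "F \<subseteq> homogeneous_elements" "T = Proj - zeros F" by blast
    define G where "G = (\<lambda>(e, f). e * f) ` (E \<times> F)"
    have hom: "G \<subseteq> homogeneous_elements"
    proof
      fix h assume "h \<in> G"
      then obtain a b where ab: "a \<in> E" "b \<in> F" "h = a * b" by (auto simp: G_def)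
      obtain d e where "homogeneous d a" "homogeneous e b"
        using EF(1,3) ab(1,2) unfolding homogeneous_elements_def by blast
      then show "h \<in> homogeneous_elements"
        using homogeneous_mult ab(3) unfolding homogeneous_elements_def by blast
    qed
    have iff: "G \<subseteq> p \<longleftrightarrow> E \<subseteq> p \<or> F \<subseteq> p" if "p \<in> Proj" for p
    proof -
      have p: "homogeneous_prime p" using that by (simp add: Proj_def)
      then have ideal: "c * a \<in> p" "a * c \<in> p" if "a \<in> p" for a c
        using that unfolding homogeneous_prime_def homogeneous_ideal_def semiring_ideal_def
        by (auto simp: mult.commute)
      have prime: "a \<in> p \<or> b \<in> p" if "a \<in> E" "b \<in> F" "a * b \<in> p" for a b
        using p that EF(1,3) unfolding homogeneous_prime_def by blast
      show ?thesis
      proof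
        assume "G \<subseteq> p"
        then have "a \<in> p \<or> b \<in> p" if "a \<in> E" "b \<in> F" for a b
          using prime[OF that] that by (force simp: G_def)
        then show "E \<subseteq> p \<or> F \<subseteq> p" by blast
      next
        assume "E \<subseteq> p \<or> F \<subseteq> p"
        then show "G \<subseteq> p" using ideal by (auto simp: G_def)
      qed
    qed
    have "zeros G = zeros E \<union> zeros F"
    proof (rule set_eqI)
      fix p show "p \<in> zeros G \<longleftrightarrow> p \<in> zeros E \<union> zeros F"
        using iff[of p] by (cases "p \<in> Proj") (simp_all add: zeros_def)
    qed
    then have "S \<inter> T = Proj - zeros G" by (simp add: EF Diff_Un)
    with hom show "?L (S \<inter> T)" by blast
  next
    fix K assume "\<forall>S\<in>K. ?L S"
    then obtain E where E: "\<forall>S\<in>K. E S \<subseteq> homogeneous_elements \<and> S = Proj - zeros (E S)"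
      unfolding bchoice_iff by (elim exE)
    have "\<Union>K = Proj - zeros (\<Union>S\<in>K. E S)"
    proof (rule set_eqI)
      fix p
      have "p \<in> S \<longleftrightarrow> p \<in> Proj \<and> \<not> E S \<subseteq> p" if "S \<in> K" for S
      proof -
        have "p \<in> S \<longleftrightarrow> p \<in> Proj - zeros (E S)" using E that by (metis (lifting))
        then show ?thesis by (auto simp: zeros_def)
      qed
      then have "p \<in> \<Union>K \<longleftrightarrow> p \<in> Proj \<and> (\<exists>S\<in>K. \<not> E S \<subseteq> p)"
        by (simp add: Bex_def)
      then show "p \<in> \<Union>K \<longleftrightarrow> p \<in> Proj - zeros (\<Union>S\<in>K. E S)"
        by (cases "p \<in> Proj") (simp_all add: zeros_def UN_subset_iff)
    qed
    moreover have "(\<Union>S\<in>K. E S) \<subseteq> homogeneous_elements" using E by (simp add: UN_subset_iff)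
    ultimately show "?L (\<Union>K)" by (intro exI conjI)
  qed
  then show ?thesis by (simp add: zariski_def)
qed

definition irreducible_in :: "'p topology \<Rightarrow> 'p set \<Rightarrow> bool" where
  "irreducible_in X Z \<longleftrightarrow> Z \<subseteq> topspace X \<and> Z \<noteq> {} \<and>
     (\<forall>A B. closedin X A \<and> closedin X B \<and> Z \<subseteq> A \<union> B \<longrightarrow> Z \<subseteq> A \<or> Z \<subseteq> B)"

text \<open>
  Elements of the local semiring at a homogeneous prime \<open>p\<close> are classes of fractions \<open>a / b\<close>, encoded as
  pairs. For a homogeneous congruence \<open>C\<close> on \<open>S\<close>, \<open>local_congruence p C\<close> is the congruence that \<open>C\<close>
  induces on these fractions, so the local semiring of \<open>S/C\<close> is its quotient; for \<open>C = Id\<close> one gets the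
  local semiring of \<open>S\<close> itself.
\<close>

type_synonym ('n, 'a) fraction = "('n, 'a) mpoly \<times> ('n, 'a) mpoly"

definition fractions ::
    "('n::finite, 'a::comm_semiring_1) mpoly set \<Rightarrow> ('n, 'a) fraction set" where
  "fractions p = {(a, b). b \<notin> p \<and> (\<exists>d. homogeneous d a \<and> homogeneous d b)}"

definition local_congruence ::
    "('n::finite, 'a::comm_semiring_1) mpoly set \<Rightarrow> ('n, 'a) mpoly rel \<Rightarrow> ('n, 'a) fraction rel"
  where
  "local_congruence p C = {((a, b), (a', b')).
     (a, b) \<in> fractions p \<and> (a', b') \<in> fractions p \<and>
     (\<exists>u\<in>homogeneous_elements. u \<notin> p \<and> (u * a * b', u * a' * b) \<in> C)}"

text \<open>
  Sections of the structure sheaf of \<open>Proj S\<close> over \<open>U\<close>: they assign to each point \<open>p\<close> of \<open>U\<close> an element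
  of the local semiring at \<open>p\<close>, and are locally given by a single fraction. Outside \<open>U\<close> they take the
  dummy value \<open>{}\<close>.
\<close>

type_synonym ('n, 'a) section_fun = "('n, 'a) mpoly set \<Rightarrow> ('n, 'a) fraction set"

definition structure_sheaf ::
    "('n::finite, 'a::comm_semiring_1) mpoly set set \<Rightarrow> ('n, 'a) section_fun set" where
  "structure_sheaf U = {s. (\<forall>p. p \<notin> U \<longrightarrow> s p = {}) \<and>
     (\<forall>p\<in>U. \<exists>W a b. openin zariski W \<and> p \<in> W \<and> W \<subseteq> U \<and>
        (\<forall>q\<in>W. (a, b) \<in> fractions q \<and> s q = local_congruence q Id `` {(a, b)}))}"

text \<open>
  A closed subscheme of \<open>Proj S\<close> is given by its quasi-coherent congruence sheaf, that is, by a congruence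
  on the semiring of sections over each open set. The one of \<open>Proj (S/C)\<close> consists of the pairs of
  sections whose values at each point are identified by the localization of \<open>C\<close>. Sets that are not open
  get the dummy value \<open>{}\<close>.
\<close>

type_synonym ('n, 'a) closed_subscheme =
  "('n, 'a) mpoly set set \<Rightarrow> ('n, 'a) section_fun rel"

definition Proj_quotient ::
    "('n::finite, 'a::comm_semiring_1) mpoly rel \<Rightarrow> ('n, 'a) closed_subscheme" where
  "Proj_quotient C U = {(s, t). openin zariski U \<and>
     s \<in> structure_sheaf U \<and> t \<in> structure_sheaf U \<and>
     (\<forall>p\<in>U. s p \<times> t p \<subseteq> local_congruence p C)}"


section \<open>Scheme-theoretic tropicalization\<close>

definition trop_submodule :: "('n, trop) mpoly set \<Rightarrow> bool" where
  "trop_submodule M \<longleftrightarrow> 0 \<in> M \<and> (\<forall>a\<in>M. \<forall>b\<in>M. a + b \<in> M) \<and> (\<forall>c. \<forall>a\<in>M. cmult c a \<in> M)"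

definition module_congruence :: "('n, trop) mpoly rel \<Rightarrow> bool" where
  "module_congruence C \<longleftrightarrow> equiv UNIV C \<and>
     (\<forall>a b a' b'. (a, b) \<in> C \<and> (a', b') \<in> C \<longrightarrow> (a + a', b + b') \<in> C) \<and>
     (\<forall>c a b. (a, b) \<in> C \<longrightarrow> (cmult c a, cmult c b) \<in> C)"

definition trop_poly :: "('k::field \<Rightarrow> trop) \<Rightarrow> ('n, 'k) mpoly \<Rightarrow> ('n, trop) mpoly" where
  "trop_poly \<nu> f = Poly_Mapping.map \<nu> f"

definition trop_ideal :: "('k::field \<Rightarrow> trop) \<Rightarrow> ('n, 'k) mpoly set \<Rightarrow> ('n, trop) mpoly set" where
  "trop_ideal \<nu> I = trop_submodule hull (trop_poly \<nu> ` I)"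

definition bend_relations :: "('n, trop) mpoly \<Rightarrow> ('n, trop) mpoly rel" where
  "bend_relations h = {(h, Poly_Mapping.update m 0 h) |m. m \<in> Poly_Mapping.keys h}"

definition bend_congruence :: "('n, trop) mpoly set \<Rightarrow> ('n, trop) mpoly rel" where
  "bend_congruence J = module_congruence hull (\<Union>h\<in>J. bend_relations h)"

definition Trop ::
    "('k::field \<Rightarrow> trop) \<Rightarrow> ('n::finite, 'k) mpoly set \<Rightarrow> ('n, trop) closed_subscheme" where
  "Trop \<nu> I = Proj_quotient (bend_congruence (trop_ideal \<nu> I))"

definition principal_ideal :: "'a::comm_semiring_1 \<Rightarrow> 'a set" where
  "principal_ideal f = {h. f dvd h}"


section \<open>Hypersurfaces and their facet multiplicities\<close>

text \<open>
  The equation \<open>f\<close> is not required to be squarefree, so a non-reduced hypersurface whose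
  underlying space is irreducible is included.
\<close>

definition irreducible_hypersurface :: "('n::finite, 'k::field) mpoly \<Rightarrow> bool" where
  "irreducible_hypersurface f \<longleftrightarrow> f \<noteq> 0 \<and> (\<exists>d>0. homogeneous d f) \<and>
     irreducible_in zariski (zeros (principal_ideal f))"

text \<open>
  Each class of \<open>\<real>\<^sup>n\<^sup>+\<^sup>1/\<real>(1,\<dots>,1)\<close> is represented by its unique member with coordinate sum zero.
\<close>

definition torus :: "(real ^ 'n::finite) set" where
  "torus = {w. (\<Sum>i\<in>UNIV. w $ i) = 0}"

definition term_at ::
    "('n::finite, trop) mpoly \<Rightarrow> ('n \<Rightarrow>\<^sub>0 nat) \<Rightarrow> real ^ 'n \<Rightarrow> trop" where
  "term_at h u w =
     Poly_Mapping.lookup h u * Fin (\<Sum>i\<in>UNIV. real (Poly_Mapping.lookup u i) * w $ i)"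

definition max_exps :: "('n::finite, trop) mpoly \<Rightarrow> real ^ 'n \<Rightarrow> ('n \<Rightarrow>\<^sub>0 nat) set" where
  "max_exps h w =
     {u \<in> Poly_Mapping.keys h. \<forall>v\<in>Poly_Mapping.keys h. term_at h v w \<le> term_at h u w}"

definition tropical_hypersurface :: "('n::finite, trop) mpoly \<Rightarrow> (real ^ 'n) set" where
  "tropical_hypersurface h = {w \<in> torus. card (max_exps h w) \<ge> 2}"

text \<open>
  Cells are relatively open: a cell consists of the points with exactly the given set of maximizing
  exponents. A facet has dimension \<open>n - 1 = CARD('n) - 2\<close>.
\<close>

definition cell :: "('n::finite, trop) mpoly \<Rightarrow> ('n \<Rightarrow>\<^sub>0 nat) set \<Rightarrow> (real ^ 'n) set" where
  "cell h A = {w \<in> torus. max_exps h w = A}"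

definition facets :: "('n::finite, trop) mpoly \<Rightarrow> (real ^ 'n) set set" where
  "facets h = {F. (\<exists>w\<in>tropical_hypersurface h. F = cell h (max_exps h w)) \<and>
     aff_dim F = int CARD('n) - 2}"

definition exp_vector :: "('n::finite \<Rightarrow>\<^sub>0 nat) \<Rightarrow> real ^ 'n" where
  "exp_vector u = (\<chi> i. real (Poly_Mapping.lookup u i))"

text \<open>For a segment with endpoints in the lattice: one less than its number of lattice points.\<close>

definition lattice_length :: "(real ^ 'n::finite) set \<Rightarrow> nat" where
  "lattice_length S = card {x \<in> S. \<forall>i. x $ i \<in> \<int>} - 1"

definition multiplicity_at :: "('n::finite, trop) mpoly \<Rightarrow> real ^ 'n \<Rightarrow> nat" where
  "multiplicity_at h w = lattice_length (convex hull (exp_vector ` max_exps h w))"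

end

theory Submission
  imports Defs
begin

text \<open>
  The scheme determines the tropical polynomial: if \<open>Trop(V(f)) = Trop(V(g))\<close>, then \<open>\<nu>(f)\<close> and
  \<open>\<nu>(g)\<close> differ by a tropical scalar. Such a scalar does not change which exponents attain the maximum
  at a point, and the hypersurface, its facets and the multiplicities are read off from these
  exponents.

  Write \<open>C(f)\<close> for the congruence \<open>\<B>(trop((f)))\<close>. It contains all the bend relations
  \<open>\<nu>(f) \<sim> \<nu>(f)\<^sub>e\<close>, where the index \<open>e\<close> means that the term of exponent \<open>e\<close> is deleted. Divided by
  \<open>x\<^sub>i\<^sup>d\<close>, the two sides become sections over the open set \<open>x\<^sub>i \<noteq> 0\<close>, and equality of the closed
  subschemes says that they agree locally modulo \<open>C(g)\<close>. The semiring
  \<open>\<T>[x\<^sub>0/x\<^sub>i,\<dots>,x\<^sub>n/x\<^sub>i]\<close> is local, because nothing cancels in a tropical sum and so its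
  non-units form an ideal. At the corresponding point of \<open>Proj\<close> the only homogeneous denominators are
  the monomials \<open>c x\<^sub>i\<^sup>N\<close>. Hence \<open>C(g)\<close> contains the bend relation of \<open>\<nu>(f)\<close> at \<open>e\<close> after
  multiplication by such a monomial (\<open>Proj_quotient_eq_imp_monomial_multiple\<close>).

  It remains to see what it means that \<open>C(g)\<close> contains the bend relation at \<open>e'\<close> of a tropical
  polynomial \<open>h\<close>. Every linear form \<open>y\<close> that annihilates \<open>(g)\<close> tropicalizes to a function
  \<open>h \<mapsto> max\<^sub>u (\<nu>(y\<^sub>u) + h\<^sub>u)\<close> which is constant on the classes of \<open>C(g)\<close>
  (\<open>bend_congruence_sum_eq\<close>), so for no such \<open>y\<close> the term at \<open>e'\<close> is the strict maximum. A
  non-archimedean version of Farkas' lemma (\<open>nonarchimedean_farkas\<close>) turns the absence of \<open>y\<close> into the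
  existence of an element of \<open>(g)\<close> whose valuation, suitably scaled, lies below \<open>h\<close> and touches it at
  \<open>e'\<close>. For \<open>h = c x\<^sub>i\<^sup>N \<nu>(f)\<close> its support is divisible by \<open>x\<^sub>i\<^sup>N\<close>. Since \<open>x\<^sub>i\<close> does not divide
  \<open>g\<close>, which is where irreducibility and the position relative to the coordinate hyperplanes enter
  (\<open>irreducible_hypersurface_not_var_dvd\<close>), one may divide by \<open>x\<^sub>i\<^sup>N\<close> and obtains a multiple of \<open>g\<close>
  of the degree of \<open>f\<close> that lies below \<open>\<nu>(f)\<close> and touches it at \<open>e\<close>.

  So \<open>deg g \<le> deg f\<close>, and by symmetry the degrees agree. The multiple is therefore a scalar multiple of
  \<open>g\<close>: for every exponent \<open>e\<close> of \<open>f\<close>, the difference \<open>\<nu>(g\<^sub>u) - \<nu>(f\<^sub>u)\<close> is largest at \<open>u = e\<close>.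
  Together with the same statement for \<open>f\<close> and \<open>g\<close> exchanged, this makes the difference constant.
\<close>

section \<open>Order and arithmetic of the tropical semifield\<close>

lemma trop_zero_le [simp]: "0 \<le> (x::trop)"
  by (simp add: zero_trop_def)

lemma trop_le_zero_iff [simp]: "(x::trop) \<le> 0 \<longleftrightarrow> x = 0"
  by (cases x) (auto simp: zero_trop_def)

lemma trop_zero_less_iff: "0 < (x::trop) \<longleftrightarrow> x \<noteq> 0"
  using less_le[of 0 x] by auto

lemma trop_mult_left_mono: "a \<le> b \<Longrightarrow> (c::trop) * a \<le> c * b"
  by (cases a; cases b; cases c) auto

lemma trop_mult_mono: "a \<le> b \<Longrightarrow> c \<le> d \<Longrightarrow> (a::trop) * c \<le> b * d"
  by (cases a; cases b; cases c; cases d) auto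

lemma trop_mult_le_cancel: "(c::trop) \<noteq> 0 \<Longrightarrow> c * a \<le> c * b \<longleftrightarrow> a \<le> b"
  by (cases a; cases b; cases c) (auto simp: zero_trop_def)

lemma trop_mult_less_cancel: "(c::trop) \<noteq> 0 \<Longrightarrow> c * a < c * b \<longleftrightarrow> a < b"
  by (simp add: trop_mult_le_cancel flip: not_le)

lemma trop_mult_eq_zero [simp]: "(a::trop) * b = 0 \<longleftrightarrow> a = 0 \<or> b = 0"
  by (cases a; cases b) (auto simp: zero_trop_def)

lemma trop_add_eq_zero [simp]: "(a::trop) + b = 0 \<longleftrightarrow> a = 0 \<and> b = 0"
  by (cases a; cases b) (auto simp: zero_trop_def plus_trop_def max_def)

lemma trop_sum_le_iff:
  "finite A \<Longrightarrow> (\<Sum>j\<in>A. f j) \<le> (c::trop) \<longleftrightarrow> (\<forall>j\<in>A. f j \<le> c)"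
  by (induction A rule: finite_induct) (auto simp: plus_trop_def)

lemma trop_sum_less:
  "finite A \<Longrightarrow> c \<noteq> 0 \<Longrightarrow> (\<And>j. j \<in> A \<Longrightarrow> f j < c) \<Longrightarrow> (\<Sum>j\<in>A. f j) < (c::trop)"
  by (induction A rule: finite_induct) (auto simp: plus_trop_def trop_zero_less_iff)

lemma trop_member_le_sum: "finite A \<Longrightarrow> j \<in> A \<Longrightarrow> f j \<le> (\<Sum>j\<in>A. f j :: trop)"
  using trop_sum_le_iff[of A f "\<Sum>j\<in>A. f j"] by simp

section \<open>Valuations\<close>

lemma
  assumes "valuation \<nu>"
  shows valuation_zero: "\<nu> 0 = 0" and valuation_one: "\<nu> 1 = 1"
    and valuation_mult: "\<nu> (a * b) = \<nu> a * \<nu> b"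
    and valuation_add: "\<nu> (a + b) \<le> \<nu> a + \<nu> b"
    and valuation_minus: "\<nu> (- a) = \<nu> a"
proof -
  show "\<nu> 0 = 0" "\<nu> 1 = 1" "\<nu> (a * b) = \<nu> a * \<nu> b" "\<nu> (a + b) \<le> \<nu> a + \<nu> b"
    using assms by (simp_all add: valuation_def plus_trop_def)
  have "\<nu> (- 1 * a) = \<nu> (- 1) * \<nu> a" and "\<nu> (- 1) = 1"
    using assms unfolding valuation_def by blast+
  then show "\<nu> (- a) = \<nu> a" by simp
qed

lemma valuation_eq_zero_iff:
  assumes "valuation \<nu>"
  shows "\<nu> a = 0 \<longleftrightarrow> a = 0"
proof
  assume "\<nu> a = 0"
  show "a = 0"
  proof (rule ccontr)
    assume "a \<noteq> 0"
    then have "\<nu> a * \<nu> (inverse a) = 1"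
      by (simp add: assms valuation_one flip: valuation_mult[OF assms])
    then show False using \<open>\<nu> a = 0\<close> by simp
  qed
qed (simp add: assms valuation_zero)

lemma valuation_sum:
  assumes "valuation \<nu>" "finite A"
  shows "\<nu> (\<Sum>j\<in>A. x j) \<le> (\<Sum>j\<in>A. \<nu> (x j))"
  using assms(2)
proof (induction A rule: finite_induct)
  case (insert j A)
  have "\<nu> (x j + (\<Sum>j\<in>A. x j)) \<le> \<nu> (x j) + \<nu> (\<Sum>j\<in>A. x j)"
    by (rule valuation_add[OF assms(1)])
  also have "\<dots> \<le> \<nu> (x j) + (\<Sum>j\<in>A. \<nu> (x j))"
    using insert.IH by (auto simp: plus_trop_def max_def)
  finally show ?case using insert.hyps by simp
qed (simp add: valuation_zero[OF assms(1)])

section \<open>A non-archimedean Farkas lemma\<close>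

text \<open>
  The index \<open>i\<close> maximizes the weighted size \<open>\<nu>(F\<^sub>i) - h\<^sub>i\<close>. Where \<open>h\<^sub>i = -\<infinity>\<close> and \<open>F\<^sub>i \<noteq> 0\<close> this size
  is infinite, so such an index wins outright.
\<close>
lemma exists_pivot:
  fixes F :: "'e \<Rightarrow> 'k::field" and h :: "'e \<Rightarrow> trop"
  assumes \<nu>: "valuation \<nu>" and "finite E" and "\<exists>j\<in>E. F j \<noteq> 0"
  shows "\<exists>i\<in>E. F i \<noteq> 0 \<and> (\<forall>j\<in>E. \<nu> (F j) * h i \<le> \<nu> (F i) * h j)"
proof (cases "\<exists>i\<in>E. F i \<noteq> 0 \<and> h i = 0")
  case True
  then show ?thesis by auto
next
  case False
  define S where "S = {i \<in> E. F i \<noteq> 0}"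
  have S: "finite S" "S \<noteq> {}" using assms by (auto simp: S_def)
  have pos: "\<nu> (F i) \<noteq> 0" "h i \<noteq> 0" if "i \<in> S" for i
    using that False by (auto simp: S_def valuation_eq_zero_iff[OF \<nu>])
  define r where "r = (\<lambda>i. case (\<nu> (F i), h i) of (Fin a, Fin b) \<Rightarrow> a - b | _ \<Rightarrow> 0)"
  have "Max (r ` S) \<in> r ` S" using S by simp
  then obtain i where "i \<in> S" and "r i = Max (r ` S)" by auto
  then have i: "i \<in> S" "\<And>j. j \<in> S \<Longrightarrow> r j \<le> r i"
    using S(1) by simp_all
  have "\<nu> (F j) * h i \<le> \<nu> (F i) * h j" if "j \<in> E" for j
  proof (cases "F j = 0")
    case False
    then have "j \<in> S" using that by (simp add: S_def)
    from i(2)[OF this] pos[OF this] pos[OF i(1)] show ?thesis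
      by (cases "\<nu> (F j)"; cases "h i"; cases "\<nu> (F i)"; cases "h j")
        (auto simp: r_def zero_trop_def)
  qed (simp add: valuation_zero[OF \<nu>])
  then show ?thesis using i(1) by (auto simp: S_def)
qed

text \<open>
  Either the space \<open>L\<close> has an element that lies below \<open>h\<close> and touches it at \<open>e\<close>, up to scaling, or
  some linear form \<open>y\<close> annihilating \<open>L\<close> is a certificate against this: an element \<open>F\<close> of \<open>L\<close> as
  above would make the term \<open>y\<^sub>e F\<^sub>e\<close> strictly larger than all other terms of a sum that is zero.

  The proof is Gaussian elimination with full pivoting. If the weighted size of some nonzero \<open>F\<close> in
  \<open>L\<close> is attained at \<open>e\<close>, then \<open>F\<close> is the required element. Otherwise it is attained at some \<open>i \<noteq> e\<close>
  only, and \<open>L\<close> is spanned by \<open>F\<close> and the subspace of elements vanishing at \<open>i\<close>, for which the index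
  \<open>i\<close> can be dropped. A form for this subspace extends uniquely to one that also annihilates \<open>F\<close>, and
  the choice of \<open>i\<close> is what keeps the new coordinate small.
\<close>
lemma nonarchimedean_farkas:
  fixes L :: "('e \<Rightarrow> 'k::field) set" and h :: "'e \<Rightarrow> trop"
  assumes \<nu>: "valuation \<nu>" and "finite E" and "e \<in> E" and "h e \<noteq> 0"
    and "\<And>F G c. F \<in> L \<Longrightarrow> G \<in> L \<Longrightarrow> (\<lambda>j. F j - c * G j) \<in> L"
  shows "(\<exists>F\<in>L. F e \<noteq> 0 \<and> (\<forall>j\<in>E. \<nu> (F j) * h e \<le> \<nu> (F e) * h j)) \<or>
    (\<exists>y. (\<forall>F\<in>L. (\<Sum>j\<in>E. y j * F j) = 0) \<and> y e \<noteq> 0 \<and>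
       (\<forall>j\<in>E - {e}. \<nu> (y j) * h j < \<nu> (y e) * h e))"
    (is "?primal E L \<or> ?dual E L")
  using assms(2,3,5)
proof (induction E arbitrary: L rule: finite_psubset_induct)
  case (psubset E)
  note closed = psubset.prems(2)
  show ?case
  proof (cases "\<exists>F\<in>L. \<exists>j\<in>E. F j \<noteq> 0")
    case False
    have "?dual E L"
      using False \<open>h e \<noteq> 0\<close>
      by (intro exI[of _ "\<lambda>j. if j = e then 1 else 0"])
        (auto simp: valuation_zero[OF \<nu>] valuation_one[OF \<nu>] trop_zero_less_iff intro!: sum.neutral)
    then show ?thesis ..
  next
    case True
    then obtain F where F: "F \<in> L" "\<exists>j\<in>E. F j \<noteq> 0" by blast
    obtain i where i: "i \<in> E" "F i \<noteq> 0" "\<And>j. j \<in> E \<Longrightarrow> \<nu> (F j) * h i \<le> \<nu> (F i) * h j"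
      using exists_pivot[OF \<nu> \<open>finite E\<close> F(2), of h] by blast
    have Fi: "\<nu> (F i) \<noteq> 0" using i(2) by (simp add: valuation_eq_zero_iff[OF \<nu>])
    show ?thesis
    proof (cases "\<nu> (F e) * h i < \<nu> (F i) * h e")
      case False
      then have tie: "\<nu> (F e) * h i = \<nu> (F i) * h e"
        using i(3)[OF \<open>e \<in> E\<close>] by simp
      then have hi: "h i \<noteq> 0" and "F e \<noteq> 0"
        using Fi \<open>h e \<noteq> 0\<close> by (auto simp: valuation_eq_zero_iff[OF \<nu>, symmetric])
      moreover have "\<nu> (F j) * h e \<le> \<nu> (F e) * h j" if "j \<in> E" for j
      proof -
        have "(\<nu> (F i) * h i) * (\<nu> (F j) * h e) = (\<nu> (F j) * h i) * (\<nu> (F i) * h e)"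
          by (simp add: mult_ac)
        also have "\<dots> \<le> (\<nu> (F i) * h j) * (\<nu> (F e) * h i)"
          unfolding tie by (intro trop_mult_mono i(3) that order_refl)
        also have "\<dots> = (\<nu> (F i) * h i) * (\<nu> (F e) * h j)"
          by (simp add: mult_ac)
        finally show ?thesis using Fi hi by (subst (asm) trop_mult_le_cancel) auto
      qed
      ultimately show ?thesis using F(1) by blast
    next
      case less: True
      then have "e \<noteq> i" by auto
      define L0 where "L0 = {G \<in> L. G i = 0}"
      define E0 where "E0 = E - {i}"
      have E0: "finite E0" "e \<in> E0" "E0 \<subset> E" "E = insert i E0" "i \<notin> E0"
        using i(1) \<open>e \<noteq> i\<close> \<open>e \<in> E\<close> \<open>finite E\<close> by (auto simp: E0_def)
      have "?primal E0 L0 \<or> ?dual E0 L0"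
        using E0 closed by (intro psubset.IH) (auto simp: L0_def)
      then show ?thesis
      proof
        assume "?primal E0 L0"
        then obtain G where "G \<in> L" "G i = 0" "G e \<noteq> 0"
          "\<forall>j\<in>E0. \<nu> (G j) * h e \<le> \<nu> (G e) * h j"
          by (auto simp: L0_def)
        then have "?primal E L"
          by (intro bexI[of _ G]) (auto simp: E0(4) valuation_zero[OF \<nu>])
        then show ?thesis ..
      next
        assume "?dual E0 L0"
        then obtain y where y: "\<And>G. G \<in> L0 \<Longrightarrow> (\<Sum>j\<in>E0. y j * G j) = 0" "y e \<noteq> 0"
          "\<And>j. j \<in> E0 - {e} \<Longrightarrow> \<nu> (y j) * h j < \<nu> (y e) * h e"
          by blast
        (* The only value at i for which the extended form annihilates F. *)
        define yi where "yi = - (\<Sum>j\<in>E0. y j * F j) / F i"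
        have yi: "yi * F i = - (\<Sum>j\<in>E0. y j * F j)"
          using i(2) by (simp add: yi_def)
        define z where "z = y(i := yi)"
        have z: "z i = yi" "\<And>j. j \<in> E0 \<Longrightarrow> z j = y j" "z e = y e"
          using E0(5) \<open>e \<noteq> i\<close> by (auto simp: z_def)
        have "(\<Sum>j\<in>E. z j * G j) = 0" if "G \<in> L" for G
        proof -
          define c where "c = G i / F i"
          have "(\<lambda>j. G j - c * F j) \<in> L0"
            using closed[OF that F(1), of c] i(2) by (simp add: L0_def) (simp add: c_def)
          from y(1)[OF this] have "(\<Sum>j\<in>E0. y j * G j) = c * (\<Sum>j\<in>E0. y j * F j)"
            by (simp add: algebra_simps sum_subtractf sum_distrib_left)
          also have "\<dots> = - (yi * G i)"
          proof -
            have "(\<Sum>j\<in>E0. y j * F j) = - (yi * F i)" using yi by simp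
            then show ?thesis using i(2) by (simp add: c_def)
          qed
          finally show ?thesis
            using E0(1,5) z by (simp add: E0(4) cong: sum.cong)
        qed
        moreover have "\<nu> (z j) * h j < \<nu> (z e) * h e" if "j \<in> E - {e}" for j
        proof (cases "j = i")
          case True
          have pos: "\<nu> (F i) * (\<nu> (y e) * h e) \<noteq> 0"
            using Fi y(2) \<open>h e \<noteq> 0\<close> by (simp add: valuation_eq_zero_iff[OF \<nu>])
          have small: "h i * \<nu> (y j * F j) < \<nu> (F i) * (\<nu> (y e) * h e)" if "j \<in> E0" for j
          proof (cases "j = e")
            case True
            have "\<nu> (y e) * (\<nu> (F e) * h i) < \<nu> (y e) * (\<nu> (F i) * h e)"
              using less y(2) by (simp add: trop_mult_less_cancel valuation_eq_zero_iff[OF \<nu>])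
            then show ?thesis using True by (simp add: valuation_mult[OF \<nu>] mult_ac)
          next
            case False
            have "h i * \<nu> (y j * F j) = \<nu> (y j) * (\<nu> (F j) * h i)"
              by (simp add: valuation_mult[OF \<nu>] mult_ac)
            also have "\<dots> \<le> \<nu> (y j) * (\<nu> (F i) * h j)"
              using i(3)[of j] that E0(4) by (intro trop_mult_left_mono) auto
            also have "\<dots> = \<nu> (F i) * (\<nu> (y j) * h j)"
              by (simp add: mult_ac)
            also have "\<dots> < \<nu> (F i) * (\<nu> (y e) * h e)"
              using y(3)[of j] that False Fi by (simp add: trop_mult_less_cancel)
            finally show ?thesis .
          qed
          have "\<nu> (F i) * (\<nu> yi * h i) = h i * \<nu> (yi * F i)"
            by (simp add: valuation_mult[OF \<nu>] mult_ac)
          also have "\<dots> \<le> h i * (\<Sum>j\<in>E0. \<nu> (y j * F j))"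
            unfolding yi valuation_minus[OF \<nu>]
            by (intro trop_mult_left_mono valuation_sum \<nu> E0(1))
          also have "\<dots> = (\<Sum>j\<in>E0. h i * \<nu> (y j * F j))"
            by (rule sum_distrib_left)
          also have "\<dots> < \<nu> (F i) * (\<nu> (y e) * h e)"
            by (rule trop_sum_less[OF E0(1) pos small])
          finally show ?thesis
            using True z Fi by (simp add: trop_mult_less_cancel)
        next
          case False
          then show ?thesis using that y(3)[of j] z by (simp add: E0(4))
        qed
        ultimately have "?dual E L"
          using y(2) z by (intro exI[of _ z]) auto
        then show ?thesis ..
      qed
    qed
  qed
qed

section \<open>Coefficients of products of polynomials\<close>

lemma poly_mapping_monomial_induct [case_names zero monomial add]:
  fixes h :: "'a \<Rightarrow>\<^sub>0 'b::monoid_add"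
  assumes "P 0" and "\<And>m c. P (Poly_Mapping.single m c)"
    and "\<And>a b. P a \<Longrightarrow> P b \<Longrightarrow> P (a + b)"
  shows "P h"
proof (induction h rule: update_induct)
  case (update h m c)
  have "Poly_Mapping.update m c h = h + Poly_Mapping.single m c"
    using update.hyps by (intro poly_mapping_eqI)
      (auto simp: lookup_update lookup_add lookup_single in_keys_iff when_def)
  then show ?case using update assms(2,3) by metis
qed (use assms in simp)

lemma split_off_monomial:
  fixes h :: "'a \<Rightarrow>\<^sub>0 'b::monoid_add"
  shows "h = Poly_Mapping.single m (Poly_Mapping.lookup h m) + Poly_Mapping.update m 0 h"
  by (rule poly_mapping_eqI) (simp add: lookup_add lookup_single lookup_update when_def)

lemma lookup_monomial_times:
  fixes h :: "'m::cancel_comm_monoid_add \<Rightarrow>\<^sub>0 'a::semiring_0"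
  shows "Poly_Mapping.lookup (Poly_Mapping.single m c * h) (m + u) = c * Poly_Mapping.lookup h u"
  by (induction h rule: poly_mapping_monomial_induct)
    (simp_all add: mult_single lookup_single lookup_add when_def distrib_left)

lemma keys_monomial_times_subset:
  fixes h :: "'m::cancel_comm_monoid_add \<Rightarrow>\<^sub>0 'a::semiring_0"
  shows "Poly_Mapping.keys (Poly_Mapping.single m c * h) \<subseteq> (+) m ` Poly_Mapping.keys h"
  using keys_mult[of "Poly_Mapping.single m c" h] by (auto split: if_splits)

lemma lookup_monomial_times_eq_0:
  fixes h :: "'m::cancel_comm_monoid_add \<Rightarrow>\<^sub>0 'a::semiring_0"
  assumes "v \<notin> range ((+) m)"
  shows "Poly_Mapping.lookup (Poly_Mapping.single m c * h) v = 0"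
  using keys_monomial_times_subset[of m c h] assms by (auto simp: in_keys_iff)

lemma monomial_times_eqI:
  fixes h F :: "'m::cancel_comm_monoid_add \<Rightarrow>\<^sub>0 'a::semiring_1"
  assumes "\<And>u. Poly_Mapping.lookup F (m + u) = Poly_Mapping.lookup h u"
    and "\<And>v. v \<in> Poly_Mapping.keys F \<Longrightarrow> v \<in> range ((+) m)"
  shows "F = Poly_Mapping.single m 1 * h"
proof (rule poly_mapping_eqI)
  fix v show "Poly_Mapping.lookup F v = Poly_Mapping.lookup (Poly_Mapping.single m 1 * h) v"
  proof (cases "v \<in> range ((+) m)")
    case True then show ?thesis by (auto simp: lookup_monomial_times assms(1))
  next
    case False
    moreover from this have "v \<notin> Poly_Mapping.keys F" using assms(2) by blast
    ultimately show ?thesis by (simp add: lookup_monomial_times_eq_0 in_keys_iff)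
  qed
qed

lemma monomial_times_update:
  fixes h :: "'m::cancel_comm_monoid_add \<Rightarrow>\<^sub>0 'a::semiring_1"
  shows "Poly_Mapping.single m c * Poly_Mapping.update u 0 h =
    Poly_Mapping.update (m + u) 0 (Poly_Mapping.single m c * h)"
proof (rule poly_mapping_eqI)
  fix v
  show "Poly_Mapping.lookup (Poly_Mapping.single m c * Poly_Mapping.update u 0 h) v =
    Poly_Mapping.lookup (Poly_Mapping.update (m + u) 0 (Poly_Mapping.single m c * h)) v"
  proof (cases "v \<in> range ((+) m)")
    case True
    then show ?thesis by (auto simp: lookup_monomial_times lookup_update)
  next
    case False
    then show ?thesis by (simp add: lookup_monomial_times_eq_0 lookup_update)
  qed
qed

text \<open>
  A coefficient of a product that receives a single contribution cannot cancel; over a field this is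
  how products are shown to have a given monomial.
\<close>
lemma lookup_mult_unique_sum:
  fixes a b :: "'m::cancel_comm_monoid_add \<Rightarrow>\<^sub>0 'a::semiring_0"
  assumes "\<And>u' v'. u' \<in> Poly_Mapping.keys a \<Longrightarrow> v' \<in> Poly_Mapping.keys b \<Longrightarrow> u' + v' = u + v \<Longrightarrow> u' = u"
  shows "Poly_Mapping.lookup (a * b) (u + v) = Poly_Mapping.lookup a u * Poly_Mapping.lookup b v"
proof -
  define a' where "a' = Poly_Mapping.update u 0 a"
  have a: "a = Poly_Mapping.single u (Poly_Mapping.lookup a u) + a'"
    unfolding a'_def by (rule split_off_monomial)
  have "u + v \<notin> Poly_Mapping.keys (a' * b)"
  proof
    assume "u + v \<in> Poly_Mapping.keys (a' * b)"
    then obtain u' v' where uv: "u + v = u' + v'" "u' \<in> Poly_Mapping.keys a'" "v' \<in> Poly_Mapping.keys b"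
      using keys_mult[of a' b] by blast
    then have "u' \<in> Poly_Mapping.keys a" "u' \<noteq> u"
      by (auto simp: a'_def in_keys_iff lookup_update split: if_splits)
    with uv assms[of u' v'] show False by simp
  qed
  then have "Poly_Mapping.lookup (a' * b) (u + v) = 0" by (simp add: in_keys_iff)
  then show ?thesis
    by (subst a) (simp add: distrib_right lookup_add lookup_monomial_times)
qed

text \<open>Tropical sums never cancel, so every sum of two exponents survives.\<close>
lemma trop_lookup_mult_nonzero:
  fixes a b :: "'m::cancel_comm_monoid_add \<Rightarrow>\<^sub>0 trop"
  assumes "u \<in> Poly_Mapping.keys a" "v \<in> Poly_Mapping.keys b"
  shows "u + v \<in> Poly_Mapping.keys (a * b)"
proof -
  have "a * b = Poly_Mapping.single u (Poly_Mapping.lookup a u) * b + Poly_Mapping.update u 0 a * b"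
    by (subst split_off_monomial[of a u]) (simp add: distrib_right)
  then show ?thesis
    using assms by (simp add: in_keys_iff lookup_add lookup_monomial_times)
qed

section \<open>Degrees\<close>

lemma exp_degree_add: "exp_degree (u + v) = exp_degree u + exp_degree v"
  by (simp add: exp_degree_def lookup_add sum.distrib)

lemma exp_degree_single: "exp_degree (Poly_Mapping.single i k) = k"
  by (simp add: exp_degree_def lookup_single when_def)

lemma exp_degree_zero [simp]: "exp_degree 0 = 0"
  by (simp add: exp_degree_def)

lemma exp_degree_eq_0_iff: "exp_degree u = 0 \<longleftrightarrow> u = 0"
  by (auto simp: exp_degree_def intro!: poly_mapping_eqI)

lemma exp_eq_single_sum:
  assumes "u + v = Poly_Mapping.single i k"
  shows "v = Poly_Mapping.single i (Poly_Mapping.lookup v i :: nat)"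
proof (rule poly_mapping_eqI)
  fix j
  have "Poly_Mapping.lookup u j + Poly_Mapping.lookup v j = Poly_Mapping.lookup (Poly_Mapping.single i k) j"
    by (simp add: assms[symmetric] lookup_add)
  then show "Poly_Mapping.lookup v j = Poly_Mapping.lookup (Poly_Mapping.single i (Poly_Mapping.lookup v i)) j"
    by (auto simp: lookup_single when_def split: if_splits)
qed

lemma mem_range_add_single_iff:
  "v \<in> range ((+) (Poly_Mapping.single i k)) \<longleftrightarrow> k \<le> (Poly_Mapping.lookup v i :: nat)"
proof
  assume "k \<le> Poly_Mapping.lookup v i"
  then have "v = Poly_Mapping.single i k + (v - Poly_Mapping.single i k)"
    by (intro poly_mapping_eqI) (auto simp: lookup_add lookup_minus lookup_single when_def)
  then show "v \<in> range ((+) (Poly_Mapping.single i k))" by blast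
qed (auto simp: lookup_add lookup_single)

lemma finite_exps_of_degree: "finite {u :: 'n::finite \<Rightarrow>\<^sub>0 nat. exp_degree u = d}"
proof -
  have "Poly_Mapping.lookup ` {u :: 'n \<Rightarrow>\<^sub>0 nat. exp_degree u = d} \<subseteq> (UNIV \<rightarrow>\<^sub>E {..d})"
  proof (clarsimp simp: PiE_def)
    fix u :: "'n \<Rightarrow>\<^sub>0 nat" and i
    show "Poly_Mapping.lookup u i \<le> exp_degree u"
      unfolding exp_degree_def by (rule member_le_sum) auto
  qed
  moreover have "finite (UNIV \<rightarrow>\<^sub>E {..d} :: ('n \<Rightarrow> nat) set)"
    by (intro finite_PiE) auto
  ultimately have "finite (Poly_Mapping.lookup ` {u :: 'n \<Rightarrow>\<^sub>0 nat. exp_degree u = d})"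
    by (rule finite_subset)
  then show ?thesis
    by (rule finite_imageD) (simp add: inj_on_def poly_mapping.lookup_inject)
qed

lemma lookup_hom_component:
  "Poly_Mapping.lookup (hom_component d h) u = (if exp_degree u = d then Poly_Mapping.lookup h u else 0)"
  by (simp add: hom_component_def lookup_mapp in_keys_iff when_def)

lemma homogeneous_hom_component: "homogeneous d (hom_component d h)"
  by (auto simp: homogeneous_def in_keys_iff lookup_hom_component split: if_splits)

lemma homogeneousD: "homogeneous d h \<Longrightarrow> exp_degree u \<noteq> d \<Longrightarrow> Poly_Mapping.lookup h u = 0"
  by (auto simp: homogeneous_def in_keys_iff)

text \<open>An ideal with a homogeneous generator is closed under homogeneous components.\<close>
lemma hom_component_mult:
  assumes "homogeneous d g"
  shows "hom_component (d + e) (g * q) = g * hom_component e q"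
proof -
  define r where "r = Poly_Mapping.mapp (\<lambda>u c. c when exp_degree u \<noteq> e) q"
  have r: "Poly_Mapping.lookup r u = (if exp_degree u = e then 0 else Poly_Mapping.lookup q u)" for u
    by (simp add: r_def lookup_mapp in_keys_iff when_def)
  have "q = hom_component e q + r"
    by (rule poly_mapping_eqI) (simp add: lookup_add lookup_hom_component r)
  then have gq: "g * q = g * hom_component e q + g * r"
    by (subst (1) \<open>q = _\<close>) (rule distrib_left)
  have hom: "homogeneous (d + e) (g * hom_component e q)"
    by (intro homogeneous_mult assms homogeneous_hom_component)
  have "Poly_Mapping.lookup (g * r) u = 0" if "exp_degree u = d + e" for u
  proof (rule ccontr)
    assume "Poly_Mapping.lookup (g * r) u \<noteq> 0"
    then obtain v w where "u = v + w" "v \<in> Poly_Mapping.keys g" "w \<in> Poly_Mapping.keys r"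
      using keys_mult[of g r] by (auto simp: in_keys_iff)
    then show False
      using assms that by (auto simp: homogeneous_def exp_degree_add r in_keys_iff)
  qed
  then show ?thesis
    using homogeneousD[OF hom]
    by (intro poly_mapping_eqI) (auto simp: lookup_hom_component gq lookup_add)
qed

lemma degree_le_of_lookup_mult:
  assumes "homogeneous d g" "Poly_Mapping.lookup (g * q) u \<noteq> 0"
  shows "d \<le> exp_degree u"
  using assms keys_mult[of g q] by (fastforce simp: homogeneous_def exp_degree_add in_keys_iff)

section \<open>Divisibility by powers of a variable\<close>

text \<open>
  Minimizing one coordinate after the other, as for a lexicographic order, leaves a vertex \<open>u + v\<close> of
  the sumset \<open>A + B\<close>, which decomposes in only one way. The index type carries no order, hence the
  induction over a set of coordinates.
\<close>
lemma exists_unique_sum: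
  fixes A B :: "('n \<Rightarrow>\<^sub>0 nat) set"
  assumes "finite J" "finite A" "finite B" "A \<noteq> {}" "B \<noteq> {}"
  shows "\<exists>u\<in>A. \<exists>v\<in>B. \<forall>u'\<in>A. \<forall>v'\<in>B. u' + v' = u + v \<longrightarrow>
    (\<forall>j\<in>J. Poly_Mapping.lookup u' j = Poly_Mapping.lookup u j)"
  using assms
proof (induction J arbitrary: A B rule: finite_induct)
  case (insert j J)
  let ?c = "\<lambda>u :: 'n \<Rightarrow>\<^sub>0 nat. Poly_Mapping.lookup u j"
  define least where "least S = {u \<in> S. \<forall>u'\<in>S. ?c u \<le> ?c u'}" for S
  have least: "finite (least S)" "least S \<noteq> {}" if S: "finite S" "S \<noteq> {}" for S
  proof -
    show "finite (least S)" using S by (simp add: least_def)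
    have "Min (?c ` S) \<in> ?c ` S" using S by simp
    then obtain u where "u \<in> S" "?c u = Min (?c ` S)" by auto
    then have "u \<in> least S" using S by (simp add: least_def)
    then show "least S \<noteq> {}" by blast
  qed
  have "\<exists>u\<in>least A. \<exists>v\<in>least B. \<forall>u'\<in>least A. \<forall>v'\<in>least B. u' + v' = u + v \<longrightarrow>
      (\<forall>j\<in>J. Poly_Mapping.lookup u' j = Poly_Mapping.lookup u j)"
    using insert.prems by (intro insert.IH least)
  then obtain u v where uv: "u \<in> least A" "v \<in> least B"
    "\<And>u' v'. u' \<in> least A \<Longrightarrow> v' \<in> least B \<Longrightarrow> u' + v' = u + v \<Longrightarrow>
      \<forall>j\<in>J. Poly_Mapping.lookup u' j = Poly_Mapping.lookup u j" by blast
  have "\<forall>k\<in>insert j J. Poly_Mapping.lookup u' k = Poly_Mapping.lookup u k"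
    if "u' \<in> A" "v' \<in> B" "u' + v' = u + v" for u' v'
  proof -
    have "?c u \<le> ?c u'" "?c v \<le> ?c v'" using that uv(1,2) by (simp_all add: least_def)
    moreover have "?c u' + ?c v' = ?c u + ?c v" using that(3) by (metis lookup_add)
    ultimately have eq: "?c u' = ?c u" "?c v' = ?c v" by linarith+
    then have "u' \<in> least A" "v' \<in> least B" using that uv(1,2) by (simp_all add: least_def)
    with uv(3) that(3) eq(1) show ?thesis by simp
  qed
  moreover have "u \<in> A" "v \<in> B" using uv(1,2) by (simp_all add: least_def)
  ultimately show ?case by blast
qed auto

text \<open>
  Among the monomials of \<open>a\<close> and of \<open>b\<close> that are minimal in the \<open>i\<close>-th exponent there is a pair
  whose product occurs only once in \<open>a b\<close> and so survives. The minimal exponents of \<open>x\<^sub>i\<close> thus add up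
  under multiplication, which makes \<open>x\<^sub>i\<close> a prime element.
\<close>
lemma var_power_dvd_factor:
  fixes a b :: "('n::finite, 'k::field) mpoly"
  assumes u0: "u0 \<in> Poly_Mapping.keys a" "Poly_Mapping.lookup u0 i = 0"
    and N: "\<And>w. w \<in> Poly_Mapping.keys (a * b) \<Longrightarrow> N \<le> Poly_Mapping.lookup w i"
    and w: "w \<in> Poly_Mapping.keys b"
  shows "N \<le> Poly_Mapping.lookup w i"
proof -
  define m where "m = Min ((\<lambda>v. Poly_Mapping.lookup v i) ` Poly_Mapping.keys b)"
  define A where "A = {u \<in> Poly_Mapping.keys a. Poly_Mapping.lookup u i = 0}"
  define B where "B = {v \<in> Poly_Mapping.keys b. Poly_Mapping.lookup v i = m}"
  have m_le: "m \<le> Poly_Mapping.lookup v i" if "v \<in> Poly_Mapping.keys b" for v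
    using that by (simp add: m_def)
  have "m \<in> (\<lambda>v. Poly_Mapping.lookup v i) ` Poly_Mapping.keys b"
    unfolding m_def using w by (intro Min_in) auto
  then have "B \<noteq> {}" by (auto simp: B_def)
  moreover have "A \<noteq> {}" using u0 by (auto simp: A_def)
  moreover have "finite A" "finite B" by (simp_all add: A_def B_def)
  ultimately have "\<exists>u\<in>A. \<exists>v\<in>B. \<forall>u'\<in>A. \<forall>v'\<in>B. u' + v' = u + v \<longrightarrow>
      (\<forall>j\<in>UNIV. Poly_Mapping.lookup u' j = Poly_Mapping.lookup u j)"
    by (intro exists_unique_sum finite)
  then obtain u v where uv: "u \<in> A" "v \<in> B"
    "\<And>u' v' j. u' \<in> A \<Longrightarrow> v' \<in> B \<Longrightarrow> u' + v' = u + v \<Longrightarrow>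
      Poly_Mapping.lookup u' j = Poly_Mapping.lookup u j"
    by blast
  have "u' = u" if "u' \<in> Poly_Mapping.keys a" "v' \<in> Poly_Mapping.keys b" "u' + v' = u + v" for u' v'
  proof -
    have "Poly_Mapping.lookup u' i + Poly_Mapping.lookup v' i = Poly_Mapping.lookup u i + Poly_Mapping.lookup v i"
      using that(3) by (metis lookup_add)
    then have "u' \<in> A" "v' \<in> B"
      using that(1,2) uv(1,2) m_le[OF that(2)] by (auto simp: A_def B_def)
    from uv(3)[OF this that(3)] show ?thesis by (rule poly_mapping_eqI)
  qed
  then have "Poly_Mapping.lookup (a * b) (u + v) = Poly_Mapping.lookup a u * Poly_Mapping.lookup b v"
    by (rule lookup_mult_unique_sum)
  then have "u + v \<in> Poly_Mapping.keys (a * b)"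
    using uv(1,2) by (simp add: A_def B_def in_keys_iff)
  from N[OF this] have "N \<le> m" using uv(1,2) by (simp add: A_def B_def lookup_add)
  then show ?thesis using m_le[OF w] by simp
qed

lemma divide_var_power:
  fixes F :: "('n, 'a::comm_semiring_1) mpoly"
  assumes "\<And>w. w \<in> Poly_Mapping.keys F \<Longrightarrow> N \<le> Poly_Mapping.lookup w i"
  shows "\<exists>G. F = Poly_Mapping.single (Poly_Mapping.single i N) 1 * G"
proof (intro exI monomial_times_eqI)
  let ?m = "Poly_Mapping.single i N"
  have "inj ((+) ?m)" by (simp add: inj_def)
  then show "Poly_Mapping.lookup F (?m + u) = Poly_Mapping.lookup (Poly_Mapping.map_key ((+) ?m) F) u" for u
    by (simp add: map_key.rep_eq)
  show "v \<in> range ((+) ?m)" if "v \<in> Poly_Mapping.keys F" for v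
    using assms[OF that] by (simp only: mem_range_add_single_iff)
qed

lemma monomial_times_cancel:
  fixes G H :: "'m::cancel_comm_monoid_add \<Rightarrow>\<^sub>0 'a::semiring_1"
  assumes "Poly_Mapping.single m 1 * G = Poly_Mapping.single m 1 * H"
  shows "G = H"
  by (rule poly_mapping_eqI) (metis assms lookup_monomial_times mult_1)

lemma dvd_monomial_times_cancel:
  fixes g G :: "('n::finite, 'k::field) mpoly"
  assumes u0: "u0 \<in> Poly_Mapping.keys g" "Poly_Mapping.lookup u0 i = 0"
    and "g dvd Poly_Mapping.single (Poly_Mapping.single i N) 1 * G"
  shows "g dvd G"
proof -
  let ?x = "Poly_Mapping.single (Poly_Mapping.single i N) 1 :: ('n, 'k) mpoly"
  obtain q where q: "?x * G = g * q" using assms(3) by (auto simp: dvd_def)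
  have "N \<le> Poly_Mapping.lookup w i" if "w \<in> Poly_Mapping.keys (g * q)" for w
  proof -
    have "w \<in> range ((+) (Poly_Mapping.single i N))"
      using that keys_monomial_times_subset[of "Poly_Mapping.single i N" 1 G] by (auto simp flip: q)
    then show ?thesis by (simp only: mem_range_add_single_iff)
  qed
  then have "N \<le> Poly_Mapping.lookup w i" if "w \<in> Poly_Mapping.keys q" for w
    using var_power_dvd_factor[OF u0 _ that] by blast
  then obtain q' where q': "q = ?x * q'"
    using divide_var_power[of q N i] by auto
  have "?x * G = ?x * (g * q')" using q q' by (simp add: mult_ac)
  then have "G = g * q'" by (rule monomial_times_cancel)
  then show ?thesis by simp
qed

section \<open>Tropicalized ideals and their bend congruences\<close>

lemma lookup_trop_poly:
  assumes "valuation \<nu>"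
  shows "Poly_Mapping.lookup (trop_poly \<nu> f) u = \<nu> (Poly_Mapping.lookup f u)"
  by (simp add: trop_poly_def Poly_Mapping.map.rep_eq when_def valuation_zero[OF assms])

lemma keys_trop_poly: "valuation \<nu> \<Longrightarrow> Poly_Mapping.keys (trop_poly \<nu> f) = Poly_Mapping.keys f"
  by (auto simp: in_keys_iff lookup_trop_poly valuation_eq_zero_iff)

lemma lookup_cmult:
  fixes h :: "('n, 'a::comm_semiring_1) mpoly"
  shows "Poly_Mapping.lookup (cmult c h) u = c * Poly_Mapping.lookup h u"
  using lookup_monomial_times[of 0 c h u] by (simp add: cmult_def)

lemma trop_submodule_trop_ideal: "trop_submodule (trop_ideal \<nu> I)"
  unfolding trop_ideal_def
  by (rule hull_in) (simp add: trop_submodule_def)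

lemma trop_poly_mem_trop_ideal: "F \<in> I \<Longrightarrow> trop_poly \<nu> F \<in> trop_ideal \<nu> I"
  unfolding trop_ideal_def by (intro hull_inc imageI)

lemma trop_ideal_induct:
  assumes "h \<in> trop_ideal \<nu> I" and "trop_submodule M" and "\<And>F. F \<in> I \<Longrightarrow> trop_poly \<nu> F \<in> M"
  shows "h \<in> M"
proof -
  have "trop_ideal \<nu> I \<subseteq> M"
    unfolding trop_ideal_def by (rule hull_minimal) (use assms in auto)
  then show ?thesis using assms(1) by blast
qed

lemma trop_ideal_monomial_times:
  assumes \<nu>: "valuation \<nu>" and I: "\<And>F. F \<in> I \<Longrightarrow> Poly_Mapping.single m 1 * F \<in> I"
    and h: "h \<in> trop_ideal \<nu> I"
  shows "Poly_Mapping.single m 1 * h \<in> trop_ideal \<nu> I"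
proof -
  let ?M = "{h. Poly_Mapping.single m 1 * h \<in> trop_ideal \<nu> I}"
  have "h \<in> ?M"
  proof (rule trop_ideal_induct[OF h])
    show "trop_submodule ?M"
      using trop_submodule_trop_ideal[of \<nu> I]
      by (auto simp: trop_submodule_def cmult_def distrib_left mult.left_commute)
  next
    fix F assume "F \<in> I"
    have "trop_poly \<nu> (Poly_Mapping.single m 1 * F) = Poly_Mapping.single m 1 * trop_poly \<nu> F"
    proof (rule monomial_times_eqI)
      fix v assume "v \<in> Poly_Mapping.keys (trop_poly \<nu> (Poly_Mapping.single m 1 * F))"
      then show "v \<in> range ((+) m)"
        using keys_monomial_times_subset[of m 1 F] by (auto simp: keys_trop_poly[OF \<nu>])
    qed (simp add: lookup_trop_poly[OF \<nu>] lookup_monomial_times)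
    then show "trop_poly \<nu> F \<in> ?M"
      using trop_poly_mem_trop_ideal[OF I[OF \<open>F \<in> I\<close>], of \<nu>] by simp
  qed
  then show ?thesis by simp
qed

lemma module_congruence_bend_congruence: "module_congruence (bend_congruence J)"
  unfolding bend_congruence_def
proof (rule hull_in)
  fix T :: "('n, trop) mpoly rel set" assume "Ball T module_congruence"
  then have T: "C \<in> T \<Longrightarrow> module_congruence C" for C by blast
  have equiv: "equiv UNIV C" if "C \<in> T" for C
    using T[OF that] by (simp add: module_congruence_def)
  have "equiv UNIV (\<Inter>T)"
  proof (rule equivI)
    show "refl (\<Inter>T)" using equiv by (auto simp: equiv_def refl_on_def)
    show "sym (\<Inter>T)" using equiv by (meson InterE InterI equiv_def symE symI)
    show "trans (\<Inter>T)" using equiv by (meson InterE InterI equiv_def transE transI)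
  qed simp
  then show "module_congruence (\<Inter>T)"
    using T by (simp add: module_congruence_def)
qed

lemma bend_mem_bend_congruence:
  assumes "h \<in> J"
  shows "(h, Poly_Mapping.update m 0 h) \<in> bend_congruence J"
proof (cases "m \<in> Poly_Mapping.keys h")
  case True
  then show ?thesis
    using assms unfolding bend_congruence_def by (intro hull_inc) (auto simp: bend_relations_def)
next
  case False
  then have "Poly_Mapping.update m 0 h = h"
    by (intro poly_mapping_eqI) (auto simp: lookup_update in_keys_iff)
  then show ?thesis
    using module_congruence_bend_congruence[of J]
    by (auto simp: module_congruence_def equiv_def refl_on_def)
qed

lemma bend_congruence_induct:
  assumes "(a, b) \<in> bend_congruence J" and "module_congruence C"
    and "\<And>h m. h \<in> J \<Longrightarrow> (h, Poly_Mapping.update m 0 h) \<in> C"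
  shows "(a, b) \<in> C"
proof -
  have "bend_congruence J \<subseteq> C"
    unfolding bend_congruence_def
    by (rule hull_minimal) (use assms in \<open>auto simp: bend_relations_def\<close>)
  then show ?thesis using assms(1) by blast
qed

text \<open>
  The bend congruence is generated as a congruence of modules over \<open>\<T>\<close>. It is compatible with
  multiplication by polynomials because a monomial carries the bend relations of an
  ideal to bend relations of the same ideal.
\<close>
lemma bend_congruence_mult:
  assumes J: "\<And>h m. h \<in> J \<Longrightarrow> Poly_Mapping.single m 1 * h \<in> J"
    and ab: "(a, b) \<in> bend_congruence J"
  shows "(q * a, q * b) \<in> bend_congruence J"
proof (induction q rule: poly_mapping_monomial_induct)
  case zero
  show ?case
    using module_congruence_bend_congruence[of J]
    by (simp add: module_congruence_def equiv_def refl_on_def)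
next
  case (monomial m c)
  let ?B = "bend_congruence J" and ?x = "Poly_Mapping.single m (1::trop)"
  have B: "module_congruence ?B" by (rule module_congruence_bend_congruence)
  have "(a, b) \<in> {(a, b). (?x * a, ?x * b) \<in> ?B}"
  proof (rule bend_congruence_induct[OF ab])
    have cm: "?x * cmult c a = cmult c (?x * a)" for c a
      by (simp add: cmult_def mult.left_commute)
    have equiv: "equiv UNIV ?B" using B by (simp add: module_congruence_def)
    have "equiv UNIV {(a, b). (?x * a, ?x * b) \<in> ?B}"
    proof (rule equivI)
      show "refl {(a, b). (?x * a, ?x * b) \<in> ?B}"
        using equiv by (simp add: equiv_def refl_on_def)
      show "sym {(a, b). (?x * a, ?x * b) \<in> ?B}"
        using equiv by (auto simp: equiv_def intro!: symI dest: symD)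
      show "trans {(a, b). (?x * a, ?x * b) \<in> ?B}"
        using equiv by (auto simp: equiv_def intro!: transI dest: transD)
    qed simp
    then show "module_congruence {(a, b). (?x * a, ?x * b) \<in> ?B}"
      using B by (simp add: module_congruence_def cm distrib_left)
  next
    fix h u assume "h \<in> J"
    then show "(h, Poly_Mapping.update u 0 h) \<in> {(a, b). (?x * a, ?x * b) \<in> ?B}"
      using bend_mem_bend_congruence[OF J, of h m "m + u"] by (simp add: monomial_times_update)
  qed
  then have "(cmult c (?x * a), cmult c (?x * b)) \<in> ?B"
    using B by (simp add: module_congruence_def)
  then show ?case by (simp add: cmult_def mult_single flip: mult.assoc)
next
  case (add p q)
  then show ?case
    using module_congruence_bend_congruence[of J]
    unfolding module_congruence_def distrib_right by blast
qed

text \<open>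
  If \<open>\<Sum>\<^sub>u y\<^sub>u F\<^sub>u = 0\<close>, then each term is minus the sum of the others, so its valuation is at most the
  maximum of the other valuations and may be deleted without changing the tropical sum. Thus \<open>\<nu>(y)\<close>
  defines a linear map to \<open>\<T>\<close> that respects the bend relations of \<open>\<nu>(F)\<close>, and hence the congruence
  that they generate.
\<close>
lemma bend_congruence_sum_eq:
  fixes a b :: "('n, trop) mpoly"
  assumes \<nu>: "valuation \<nu>" and "finite E"
    and y: "\<And>F. F \<in> I \<Longrightarrow> (\<Sum>u\<in>E. y u * Poly_Mapping.lookup F u) = 0"
    and ab: "(a, b) \<in> bend_congruence (trop_ideal \<nu> I)"
  shows "(\<Sum>u\<in>E. \<nu> (y u) * Poly_Mapping.lookup a u) = (\<Sum>u\<in>E. \<nu> (y u) * Poly_Mapping.lookup b u)"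
proof -
  define \<phi> where "\<phi> h = (\<Sum>u\<in>E. \<nu> (y u) * Poly_Mapping.lookup h u)" for h
  have add: "\<phi> (a + b) = \<phi> a + \<phi> b" for a b
    by (simp add: \<phi>_def lookup_add distrib_left sum.distrib)
  have scale: "\<phi> (cmult c a) = c * \<phi> a" for c a
    by (simp add: \<phi>_def lookup_cmult sum_distrib_left mult.left_commute)
  have "(a, b) \<in> {(a, b). \<phi> a = \<phi> b}"
  proof (rule bend_congruence_induct[OF ab])
    have "equiv UNIV {(a, b). \<phi> a = \<phi> b}"
      by (auto simp: equiv_def refl_on_def sym_on_def trans_def)
    then show "module_congruence {(a, b). \<phi> a = \<phi> b}"
      by (simp add: module_congruence_def add scale)
  next
    fix h m assume h: "h \<in> trop_ideal \<nu> I"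
    have "h \<in> {h. \<phi> h = \<phi> (Poly_Mapping.update m 0 h)}"
    proof (rule trop_ideal_induct[OF h])
      have upd: "Poly_Mapping.update m 0 (0 :: ('n, trop) mpoly) = 0"
        "Poly_Mapping.update m 0 (a + b) = Poly_Mapping.update m 0 a + Poly_Mapping.update m 0 b"
        "Poly_Mapping.update m 0 (cmult c a) = cmult c (Poly_Mapping.update m 0 a)"
        for a b :: "('n, trop) mpoly" and c
        by (auto intro!: poly_mapping_eqI simp: lookup_update lookup_add lookup_cmult)
      show "trop_submodule {h. \<phi> h = \<phi> (Poly_Mapping.update m 0 h)}"
        by (simp add: trop_submodule_def upd add scale)
    next
      fix F assume "F \<in> I"
      let ?h = "trop_poly \<nu> F"
      show "?h \<in> {h. \<phi> h = \<phi> (Poly_Mapping.update m 0 h)}"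
      proof (cases "m \<in> E")
        case True
        let ?t = "\<lambda>u. \<nu> (y u) * Poly_Mapping.lookup ?h u"
        have t: "?t u = \<nu> (y u * Poly_Mapping.lookup F u)" for u
          by (simp add: valuation_mult[OF \<nu>] lookup_trop_poly[OF \<nu>])
        have "y m * Poly_Mapping.lookup F m + (\<Sum>u\<in>E - {m}. y u * Poly_Mapping.lookup F u) = 0"
          using y[OF \<open>F \<in> I\<close>] by (simp add: sum.remove[OF \<open>finite E\<close> True])
        then have "?t m = \<nu> (\<Sum>u\<in>E - {m}. y u * Poly_Mapping.lookup F u)"
          unfolding t by (metis add_eq_0_iff valuation_minus[OF \<nu>])
        also have "\<dots> \<le> (\<Sum>u\<in>E - {m}. ?t u)"
          unfolding t using \<open>finite E\<close> by (intro valuation_sum[OF \<nu>]) simp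
        finally have "?t m + (\<Sum>u\<in>E - {m}. ?t u) = (\<Sum>u\<in>E - {m}. ?t u)"
          by (simp add: plus_trop_def max_absorb2)
        then have "\<phi> ?h = (\<Sum>u\<in>E - {m}. ?t u)"
          by (simp add: \<phi>_def sum.remove[OF \<open>finite E\<close> True])
        also have "\<dots> = \<phi> (Poly_Mapping.update m 0 ?h)"
          unfolding \<phi>_def
          by (subst sum.remove[OF \<open>finite E\<close> True]) (auto simp: lookup_update intro!: sum.cong split: if_splits)
        finally show ?thesis by simp
      next
        case False
        then show ?thesis by (auto simp: \<phi>_def lookup_update intro!: sum.cong)
      qed
    qed
    then show "(h, Poly_Mapping.update m 0 h) \<in> {(a, b). \<phi> a = \<phi> b}" by simp
  qed
  then show ?thesis by (simp add: \<phi>_def)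
qed

section \<open>Homogeneous primes\<close>

lemma homogeneous_prime_mult_cancel:
  assumes "homogeneous_prime p" "a \<in> homogeneous_elements" "b \<in> homogeneous_elements" "a * b \<in> p"
  shows "a \<in> p \<or> b \<in> p"
  using assms unfolding homogeneous_prime_def by blast

lemma homogeneous_elementsI: "homogeneous d h \<Longrightarrow> h \<in> homogeneous_elements"
  by (auto simp: homogeneous_elements_def)

lemma homogeneous_elements_mult:
  "a \<in> homogeneous_elements \<Longrightarrow> b \<in> homogeneous_elements \<Longrightarrow> a * b \<in> homogeneous_elements"
  by (auto simp: homogeneous_elements_def intro: homogeneous_mult)

lemma homogeneous_single: "homogeneous (exp_degree u) (Poly_Mapping.single u c)"
  by (simp add: homogeneous_def)

lemma homogeneous_one: "homogeneous 0 1"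
  using homogeneous_single[of 0 1] by simp

lemma var_power: "var i ^ d = Poly_Mapping.single (Poly_Mapping.single i d) 1"
  by (induction d) (simp_all add: var_def mult_single flip: single_add)

lemma homogeneous_var_power: "homogeneous d (var i ^ d)"
  using homogeneous_single[of "Poly_Mapping.single i d" 1] by (simp add: var_power exp_degree_single)

lemma var_power_notin_prime:
  assumes "homogeneous_prime p" "var i \<notin> p"
  shows "var i ^ d \<notin> p"
proof (induction d)
  case 0
  then show ?case using assms(1) by (simp add: homogeneous_prime_def)
next
  case (Suc d)
  then show ?case
    using homogeneous_prime_mult_cancel[OF assms(1), of "var i" "var i ^ d"] assms(2)
      homogeneous_var_power[of 1 i] homogeneous_var_power[of d i]
    by (auto intro: homogeneous_elementsI)
qed

lemma var_in_irrelevant_ideal: "var i \<in> irrelevant_ideal"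
proof -
  have "Poly_Mapping.single i 1 \<noteq> (0 :: 'a \<Rightarrow>\<^sub>0 nat)"
    using exp_degree_single[of i 1] by auto
  then show ?thesis by (simp add: irrelevant_ideal_def var_def lookup_single when_def)
qed

text \<open>
  The elements without a homogeneous component \<open>c x\<^sub>i\<^sup>N\<close>, \<open>c \<noteq> 0\<close>. This corresponds to the set of
  non-units of \<open>\<T>[x\<^sub>0/x\<^sub>i,\<dots>,x\<^sub>n/x\<^sub>i]\<close>: a tropical polynomial with a non-constant term is never a
  unit, and adding to it cannot remove that term. It is the closed point of the chart \<open>x\<^sub>i \<noteq> 0\<close>, where
  the fewest elements are inverted.
\<close>
definition vertex_prime :: "'n::finite \<Rightarrow> ('n, trop) mpoly set" where
  "vertex_prime i = {h. \<forall>N. Poly_Mapping.single i N \<in> Poly_Mapping.keys h \<longrightarrow>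
     (\<exists>v\<in>Poly_Mapping.keys h. exp_degree v = N \<and> v \<noteq> Poly_Mapping.single i N)}"

lemma homogeneous_notin_vertex_prime:
  assumes "h \<in> homogeneous_elements" "h \<notin> vertex_prime i"
  obtains N c where "c \<noteq> 0" "h = Poly_Mapping.single (Poly_Mapping.single i N) c"
proof -
  obtain N where N: "Poly_Mapping.single i N \<in> Poly_Mapping.keys h"
    "\<And>v. v \<in> Poly_Mapping.keys h \<Longrightarrow> exp_degree v = N \<Longrightarrow> v = Poly_Mapping.single i N"
    using assms(2) unfolding vertex_prime_def by blast
  obtain d where d: "\<And>u. u \<in> Poly_Mapping.keys h \<Longrightarrow> exp_degree u = d"
    using assms(1) by (auto simp: homogeneous_elements_def homogeneous_def)
  have "d = N" using d[OF N(1)] by (simp add: exp_degree_single)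
  then have zero: "Poly_Mapping.lookup h v = 0" if "v \<noteq> Poly_Mapping.single i N" for v
    using that d[of v] N(2)[of v] by (auto simp: in_keys_iff)
  show ?thesis
  proof (rule that)
    show "Poly_Mapping.lookup h (Poly_Mapping.single i N) \<noteq> 0"
      using N(1) by (simp add: in_keys_iff)
    show "h = Poly_Mapping.single (Poly_Mapping.single i N) (Poly_Mapping.lookup h (Poly_Mapping.single i N))"
      using zero by (intro poly_mapping_eqI) (auto simp: lookup_single when_def)
  qed
qed

lemma monomial_notin_vertex_prime:
  "c \<noteq> 0 \<Longrightarrow> Poly_Mapping.single (Poly_Mapping.single i N) c \<notin> vertex_prime i"
  by (auto simp: vertex_prime_def)

lemma var_notin_vertex_prime: "var i \<notin> vertex_prime i"
  by (simp add: var_def monomial_notin_vertex_prime)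

lemma vertex_prime_in_Proj: "vertex_prime i \<in> Proj"
proof -
  let ?p = "vertex_prime i"
  have mult: "c * a \<in> ?p" if a: "a \<in> ?p" for a c
    unfolding vertex_prime_def
  proof (intro CollectI allI impI)
    fix N assume "Poly_Mapping.single i N \<in> Poly_Mapping.keys (c * a)"
    then obtain u v where uv: "Poly_Mapping.single i N = u + v" "u \<in> Poly_Mapping.keys c"
      "v \<in> Poly_Mapping.keys a"
      using keys_mult[of c a] by blast
    define M where "M = Poly_Mapping.lookup v i"
    have v: "v = Poly_Mapping.single i M"
      unfolding M_def by (rule exp_eq_single_sum) (rule uv(1)[symmetric])
    obtain v' where v': "v' \<in> Poly_Mapping.keys a" "exp_degree v' = M" "v' \<noteq> v"
      using a uv(3) unfolding v vertex_prime_def by blast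
    have "exp_degree (u + v') = exp_degree (u + v)"
      by (simp add: exp_degree_add v'(2)) (simp add: v exp_degree_single)
    then have "exp_degree (u + v') = N" by (simp add: exp_degree_single flip: uv(1))
    moreover have "u + v' \<noteq> Poly_Mapping.single i N" using v'(3) by (simp add: uv(1))
    moreover have "u + v' \<in> Poly_Mapping.keys (c * a)"
      by (rule trop_lookup_mult_nonzero[OF uv(2) v'(1)])
    ultimately show "\<exists>w\<in>Poly_Mapping.keys (c * a). exp_degree w = N \<and> w \<noteq> Poly_Mapping.single i N"
      by blast
  qed
  have keys_add: "Poly_Mapping.keys (a + b) = Poly_Mapping.keys a \<union> Poly_Mapping.keys b"
    for a b :: "('a, trop) mpoly"
    by (auto simp: in_keys_iff lookup_add)
  have "semiring_ideal ?p"
    unfolding semiring_ideal_def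
  proof (intro conjI ballI allI)
    show "0 \<in> ?p" by (simp add: vertex_prime_def)
    show "a + b \<in> ?p" if "a \<in> ?p" "b \<in> ?p" for a b
      using that unfolding vertex_prime_def mem_Collect_eq keys_add by blast
  qed (rule mult)
  moreover have "hom_component d h \<in> ?p" if "h \<in> ?p" for h d
  proof -
    have "Poly_Mapping.keys (hom_component d h) = {u \<in> Poly_Mapping.keys h. exp_degree u = d}"
      by (auto simp: in_keys_iff lookup_hom_component split: if_splits)
    then show ?thesis using that by (auto simp: vertex_prime_def exp_degree_single)
  qed
  moreover have "1 \<notin> ?p"
    using monomial_notin_vertex_prime[of 1 i 0] by simp
  moreover have "a \<in> ?p \<or> b \<in> ?p"
    if hom: "a \<in> homogeneous_elements" "b \<in> homogeneous_elements" and ab: "a * b \<in> ?p" for a b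
  proof (rule ccontr)
    assume "\<not> (a \<in> ?p \<or> b \<in> ?p)"
    then obtain N c M c' where "c \<noteq> 0" "c' \<noteq> 0" "a = Poly_Mapping.single (Poly_Mapping.single i N) c"
      "b = Poly_Mapping.single (Poly_Mapping.single i M) c'"
      using hom homogeneous_notin_vertex_prime by metis
    then have "a * b \<notin> ?p"
      using monomial_notin_vertex_prime[of "c * c'" i "N + M"] by (simp add: mult_single single_add)
    then show False using ab by simp
  qed
  ultimately show ?thesis
    using var_notin_vertex_prime[of i] var_in_irrelevant_ideal[of i]
    by (auto simp: Proj_def homogeneous_prime_def homogeneous_ideal_def)
qed

section \<open>What a closed subscheme remembers of its congruence\<close>

lemma basic_open: "h \<in> homogeneous_elements \<Longrightarrow> openin zariski (Proj - zeros {h})"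
  by (auto simp: openin_zariski)

definition fraction_section ::
    "('n::finite, 'a::comm_semiring_1) mpoly set set \<Rightarrow> ('n, 'a) mpoly \<Rightarrow> ('n, 'a) mpoly \<Rightarrow>
      ('n, 'a) section_fun" where
  "fraction_section U a b = (\<lambda>q. if q \<in> U then local_congruence q Id `` {(a, b)} else {})"

lemma fraction_section_in_structure_sheaf:
  assumes "openin zariski U" "\<And>q. q \<in> U \<Longrightarrow> (a, b) \<in> fractions q"
  shows "fraction_section U a b \<in> structure_sheaf U"
  unfolding structure_sheaf_def
proof (intro CollectI conjI allI impI ballI)
  fix q assume "q \<in> U"
  then show "\<exists>W a' b'. openin zariski W \<and> q \<in> W \<and> W \<subseteq> U \<and> (\<forall>q\<in>W. (a', b') \<in> fractions q \<and>
      fraction_section U a b q = local_congruence q Id `` {(a', b')})"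
    using assms by (intro exI[of _ U] exI[of _ a] exI[of _ b]) (simp add: fraction_section_def)
qed (simp add: fraction_section_def)

text \<open>
  A pair in \<open>C\<close> gives two sections \<open>a/x\<^sub>i\<^sup>d\<close> and \<open>b/x\<^sub>i\<^sup>d\<close> over the chart \<open>x\<^sub>i \<noteq> 0\<close> that are identified
  by the congruence sheaf. Evaluated at the closed point of the chart for \<open>C'\<close>, this says that \<open>a\<close> and
  \<open>b\<close> become congruent modulo \<open>C'\<close> after multiplication by a denominator, and the denominators allowed
  there are monomials in \<open>x\<^sub>i\<close>.
\<close>
lemma Proj_quotient_eq_imp_monomial_multiple:
  fixes C C' :: "('n::finite, trop) mpoly rel"
  assumes mult: "\<And>q a b. (a, b) \<in> C \<Longrightarrow> (q * a, q * b) \<in> C"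
    and eq: "Proj_quotient C = Proj_quotient C'"
    and ab: "(a, b) \<in> C" and hom: "homogeneous d a" "homogeneous d b"
  obtains N c where "c \<noteq> 0" and "(Poly_Mapping.single (Poly_Mapping.single i N) c * a,
    Poly_Mapping.single (Poly_Mapping.single i N) c * b) \<in> C'"
proof -
  define U where "U = (Proj - zeros {var i} :: ('n, trop) mpoly set set)"
  let ?x = "var i ^ d :: ('n, trop) mpoly"
  have U: "openin zariski U"
    unfolding U_def using homogeneous_var_power[of 1 i]
    by (intro basic_open homogeneous_elementsI[of 1]) simp
  have prime: "homogeneous_prime q" and x: "?x \<notin> q" if "q \<in> U" for q
    using that var_power_notin_prime[of q i] by (auto simp: U_def Proj_def zeros_def)
  have frac: "(a, ?x) \<in> fractions q" "(b, ?x) \<in> fractions q" if "q \<in> U" for q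
    using x[OF that] hom homogeneous_var_power[of d i] by (auto simp: fractions_def)
  let ?s = "fraction_section U a ?x" and ?t = "fraction_section U b ?x"
  have x_hom: "?x \<in> homogeneous_elements"
    by (rule homogeneous_elementsI[OF homogeneous_var_power])
  have "?s q \<times> ?t q \<subseteq> local_congruence q C" if q: "q \<in> U" for q
  proof clarify
    fix a1 b1 a2 b2 assume "(a1, b1) \<in> ?s q" "(a2, b2) \<in> ?t q"
    then have 1: "((a, ?x), (a1, b1)) \<in> local_congruence q Id"
      and 2: "((b, ?x), (a2, b2)) \<in> local_congruence q Id"
      using q by (simp_all add: fraction_section_def)
    from 1 obtain u where u: "(a1, b1) \<in> fractions q" "u \<in> homogeneous_elements" "u \<notin> q"
      "u * a * b1 = u * a1 * ?x" by (auto simp: local_congruence_def)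
    from 2 obtain v where v: "(a2, b2) \<in> fractions q" "v \<in> homogeneous_elements" "v \<notin> q"
      "v * b * b2 = v * a2 * ?x" by (auto simp: local_congruence_def)
    let ?w = "u * v * ?x"
    have hom_uv: "u * v \<in> homogeneous_elements" using u(2) v(2) by (rule homogeneous_elements_mult)
    have "?w \<in> homogeneous_elements" using hom_uv x_hom by (rule homogeneous_elements_mult)
    moreover have "?w \<notin> q"
      using homogeneous_prime_mult_cancel[OF prime[OF q]] hom_uv x_hom u(2,3) v(2,3) x[OF q] by blast
    moreover have "(?w * a1 * b2, ?w * a2 * b1) \<in> C"
    proof -
      have "?w * a1 * b2 = (v * b2) * (u * a1 * ?x)" by (simp add: mult_ac)
      also have "\<dots> = (v * b2) * (u * a * b1)" by (simp only: u(4))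
      also have "\<dots> = (u * v * b1 * b2) * a" by (simp add: mult_ac)
      finally have 3: "?w * a1 * b2 = (u * v * b1 * b2) * a" .
      have "?w * a2 * b1 = (u * b1) * (v * a2 * ?x)" by (simp add: mult_ac)
      also have "\<dots> = (u * b1) * (v * b * b2)" by (simp only: v(4))
      also have "\<dots> = (u * v * b1 * b2) * b" by (simp add: mult_ac)
      finally show ?thesis using mult[OF ab] 3 by simp
    qed
    ultimately show "((a1, b1), (a2, b2)) \<in> local_congruence q C"
      using u(1) v(1) unfolding local_congruence_def by blast
  qed
  then have "(?s, ?t) \<in> Proj_quotient C U"
    using U frac by (simp add: Proj_quotient_def fraction_section_in_structure_sheaf)
  then have st: "(?s, ?t) \<in> Proj_quotient C' U" by (simp add: eq)
  let ?p = "vertex_prime i"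
  have p: "?p \<in> U"
    using vertex_prime_in_Proj[of i] var_notin_vertex_prime[of i] by (simp add: U_def zeros_def)
  have "1 \<in> homogeneous_elements" "1 \<notin> ?p"
    using homogeneous_one prime[OF p] by (auto intro: homogeneous_elementsI simp: homogeneous_prime_def)
  then have "(h, ?x) \<in> local_congruence ?p Id `` {(h, ?x)}" if "(h, ?x) \<in> fractions ?p" for h
    using that unfolding local_congruence_def by blast
  then have "((a, ?x), (b, ?x)) \<in> ?s ?p \<times> ?t ?p"
    using frac[OF p] p by (simp add: fraction_section_def)
  then have "((a, ?x), (b, ?x)) \<in> local_congruence ?p C'"
    using st p unfolding Proj_quotient_def by blast
  then obtain u where u: "u \<in> homogeneous_elements" "u \<notin> ?p" "(u * a * ?x, u * b * ?x) \<in> C'"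
    by (auto simp: local_congruence_def)
  obtain N c where Nc: "c \<noteq> 0" "u = Poly_Mapping.single (Poly_Mapping.single i N) c"
    by (rule homogeneous_notin_vertex_prime[OF u(1,2)])
  have "u * h * ?x = Poly_Mapping.single (Poly_Mapping.single i (N + d)) c * h" for h
  proof -
    have "u * h * ?x = (u * ?x) * h" by (simp add: mult_ac)
    then show ?thesis by (simp add: Nc(2) var_power mult_single single_add)
  qed
  then show ?thesis using that[OF Nc(1), of "N + d"] u(3) by simp
qed

section \<open>Irreducible hypersurfaces outside the coordinate hyperplanes\<close>

lemma topspace_zariski: "topspace zariski = Proj"
proof -
  have "openin zariski Proj"
    unfolding openin_zariski
    using homogeneous_one
    by (intro exI[of _ "{1}"])
      (auto simp: zeros_def Proj_def homogeneous_prime_def intro: homogeneous_elementsI)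
  moreover have "U \<subseteq> Proj" if "openin zariski U" for U :: "('a, 'b) mpoly set set"
    using that by (auto simp: openin_zariski)
  ultimately show ?thesis
    by (metis openin_subset openin_topspace subset_antisym)
qed

lemma closedin_zeros: "h \<in> homogeneous_elements \<Longrightarrow> closedin zariski (zeros {h})"
  by (simp add: closedin_def topspace_zariski basic_open) (auto simp: zeros_def)

lemma principal_ideal_subset_iff:
  assumes "p \<in> Proj"
  shows "principal_ideal f \<subseteq> p \<longleftrightarrow> f \<in> p"
proof
  assume "f \<in> p"
  then have "f * c \<in> p" for c
    using assms by (auto simp: Proj_def homogeneous_prime_def homogeneous_ideal_def
        semiring_ideal_def mult.commute)
  then show "principal_ideal f \<subseteq> p" by (auto simp: principal_ideal_def dvd_def)
qed (auto simp: principal_ideal_def)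

text \<open>
  The ideal \<open>(x\<^sub>i)\<close>, the generic point of a coordinate hyperplane if there is
  another variable.
\<close>
definition hyperplane_prime :: "'n::finite \<Rightarrow> ('n, 'k::field) mpoly set" where
  "hyperplane_prime i = {h. \<forall>u\<in>Poly_Mapping.keys h. 1 \<le> Poly_Mapping.lookup u i}"

lemma hyperplane_prime_in_Proj:
  fixes i j :: "'n::finite"
  assumes "j \<noteq> i"
  shows "(hyperplane_prime i :: ('n, 'k::field) mpoly set) \<in> Proj"
proof -
  let ?q = "hyperplane_prime i :: ('n, 'k) mpoly set"
  have "semiring_ideal ?q"
    unfolding semiring_ideal_def
  proof (intro conjI ballI allI)
    show "0 \<in> ?q" by (simp add: hyperplane_prime_def)
    show "a + b \<in> ?q" if "a \<in> ?q" "b \<in> ?q" for a b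
      using that keys_add[of a b] by (auto simp: hyperplane_prime_def)
    show "c * a \<in> ?q" if "a \<in> ?q" for a c
      using that keys_mult[of c a] by (fastforce simp: hyperplane_prime_def lookup_add)
  qed
  moreover have "hom_component d h \<in> ?q" if "h \<in> ?q" for h d
    using that by (auto simp: hyperplane_prime_def in_keys_iff lookup_hom_component split: if_splits)
  moreover have "1 \<notin> ?q" by (simp add: hyperplane_prime_def)
  moreover have "a \<in> ?q \<or> b \<in> ?q" if "a * b \<in> ?q" for a b
  proof (rule disjCI)
    assume "b \<notin> ?q"
    then obtain u0 where "u0 \<in> Poly_Mapping.keys b" "Poly_Mapping.lookup u0 i = 0"
      by (auto simp: hyperplane_prime_def not_le)
    then show "a \<in> ?q"
      using var_power_dvd_factor[of u0 b i a 1] that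
      by (simp add: hyperplane_prime_def mult.commute)
  qed
  moreover have "var j \<notin> ?q"
    using assms by (simp add: hyperplane_prime_def var_def lookup_single when_def)
  ultimately show ?thesis
    using var_in_irrelevant_ideal[of j]
    by (auto simp: Proj_def homogeneous_prime_def homogeneous_ideal_def)
qed

text \<open>
  Write \<open>f = x\<^sub>i\<^sup>N f'\<close> with \<open>f'\<close> not divisible by \<open>x\<^sub>i\<close>. The hypersurface is contained in the union
  of the hyperplane and \<open>V(f')\<close>, hence by irreducibility in \<open>V(f')\<close>. If \<open>N > 0\<close>, it contains the generic
  point of the hyperplane, at which \<open>f'\<close> would then vanish. In the case of a single variable the
  hyperplane is empty and has no generic point, but then \<open>f'\<close> is a nonzero constant.
\<close>
lemma irreducible_hypersurface_not_var_dvd: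
  fixes f :: "('n::finite, 'k::field) mpoly"
  assumes irr: "irreducible_hypersurface f" and nsub: "\<not> zeros (principal_ideal f) \<subseteq> zeros {var i}"
  obtains u where "u \<in> Poly_Mapping.keys f" "Poly_Mapping.lookup u i = 0"
proof (rule ccontr)
  assume "\<not> thesis"
  with that have pos: "1 \<le> Poly_Mapping.lookup u i" if "u \<in> Poly_Mapping.keys f" for u
    using \<open>u \<in> Poly_Mapping.keys f\<close> by (metis less_one not_le)
  obtain d where "f \<noteq> 0" and f: "homogeneous d f"
    and irr': "irreducible_in zariski (zeros (principal_ideal f))"
    using irr by (auto simp: irreducible_hypersurface_def)
  define N where "N = Min ((\<lambda>u. Poly_Mapping.lookup u i) ` Poly_Mapping.keys f)"
  have "N \<in> (\<lambda>u. Poly_Mapping.lookup u i) ` Poly_Mapping.keys f"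
    unfolding N_def using \<open>f \<noteq> 0\<close> by (intro Min_in) auto
  then obtain u0 where u0: "u0 \<in> Poly_Mapping.keys f" "Poly_Mapping.lookup u0 i = N" by auto
  have N_le: "N \<le> Poly_Mapping.lookup u i" if "u \<in> Poly_Mapping.keys f" for u
    using that by (simp add: N_def)
  let ?m = "Poly_Mapping.single i N"
  obtain f' where f': "f = Poly_Mapping.single ?m 1 * f'"
    using divide_var_power[of f N i] N_le by auto
  have coeff: "Poly_Mapping.lookup f' u = Poly_Mapping.lookup f (?m + u)" for u
    by (simp add: f' lookup_monomial_times)
  have hom': "homogeneous (d - N) f'"
    unfolding homogeneous_def
  proof
    fix u assume "u \<in> Poly_Mapping.keys f'"
    then have "exp_degree (?m + u) = d"
      using f by (simp add: homogeneous_def in_keys_iff coeff)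
    then show "exp_degree u = d - N" by (simp add: exp_degree_add exp_degree_single)
  qed
  have "u0 \<in> range ((+) ?m)" using u0 by (simp only: mem_range_add_single_iff)
  then obtain u1 where u1: "u0 = ?m + u1" by blast
  then have u1': "u1 \<in> Poly_Mapping.keys f'" "Poly_Mapping.lookup u1 i = 0"
    using u0 by (simp_all add: in_keys_iff coeff lookup_add)
  have split: "var i \<in> p \<or> f' \<in> p" if p: "p \<in> Proj" "f \<in> p" for p
  proof (rule ccontr)
    assume neg: "\<not> (var i \<in> p \<or> f' \<in> p)"
    have prime: "homogeneous_prime p" using p by (simp add: Proj_def)
    have "var i ^ N \<notin> p" using var_power_notin_prime[OF prime] neg by blast
    moreover have "f = var i ^ N * f'" by (simp add: f' var_power)
    ultimately show False
      using homogeneous_prime_mult_cancel[OF prime, of "var i ^ N" f'] neg p(2)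
        homogeneous_elementsI[OF homogeneous_var_power[of N i]] homogeneous_elementsI[OF hom']
      by auto
  qed
  obtain p where "p \<in> zeros (principal_ideal f)" "p \<notin> zeros {var i}" using nsub by blast
  then have p: "p \<in> Proj" "f \<in> p" "var i \<notin> p"
    using principal_ideal_subset_iff[of p f] by (auto simp: zeros_def)
  then have "f' \<in> p" using split by blast
  show False
  proof (cases "\<exists>j. j \<noteq> i")
    case True
    then obtain j where "j \<noteq> i" by blast
    have "closedin zariski (zeros {var i :: ('n, 'k) mpoly})"
      using homogeneous_var_power[of 1 i] by (intro closedin_zeros homogeneous_elementsI[of 1]) simp
    moreover have "closedin zariski (zeros {f'})"
      by (intro closedin_zeros homogeneous_elementsI[OF hom'])
    moreover have "zeros (principal_ideal f) \<subseteq> zeros {var i} \<union> zeros {f'}"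
      by (auto simp: zeros_def principal_ideal_subset_iff dest: split)
    ultimately have "zeros (principal_ideal f) \<subseteq> zeros {f'}"
      using irr' nsub unfolding irreducible_in_def by blast
    moreover have "hyperplane_prime i \<in> zeros (principal_ideal f)"
      using hyperplane_prime_in_Proj[OF \<open>j \<noteq> i\<close>, where 'k = 'k] pos
      by (auto simp: zeros_def principal_ideal_subset_iff hyperplane_prime_def)
    ultimately have "f' \<in> hyperplane_prime i" by (auto simp: zeros_def)
    then show False using u1' by (auto simp: hyperplane_prime_def)
  next
    case False
    then have "u1 = 0" using u1'(2) by (intro poly_mapping_eqI) (metis lookup_zero)
    then have "homogeneous 0 f'"
      using hom' u1'(1) by (auto simp: homogeneous_def)
    then have "f' = Poly_Mapping.single 0 (Poly_Mapping.lookup f' 0)"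
      by (intro poly_mapping_eqI)
        (auto simp: lookup_single when_def exp_degree_eq_0_iff intro!: homogeneousD)
    moreover have "Poly_Mapping.lookup f' 0 \<noteq> 0"
      using u1'(1) \<open>u1 = 0\<close> by (simp add: in_keys_iff)
    ultimately have "Poly_Mapping.single 0 (inverse (Poly_Mapping.lookup f' 0)) * f' = 1"
      by (metis add_0 left_inverse mult_single single_one)
    then have "1 \<in> p"
      using p(1) \<open>f' \<in> p\<close>
      by (metis (no_types, lifting) Proj_def homogeneous_ideal_def homogeneous_prime_def
          mem_Collect_eq semiring_ideal_def)
    then show False using p(1) by (simp add: Proj_def homogeneous_prime_def)
  qed
qed

section \<open>The congruence determines the tropical polynomial\<close>

text \<open>
  The linear alternative is applied to the coefficients in degree \<open>N + D\<close>, where there are only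
  finitely many monomials. A dual solution \<open>y\<close> is excluded because its tropicalization would separate
  the two sides of the bend relation. A primal solution is an element of \<open>(g)\<close> that is dominated by
  \<open>c x\<^sub>i\<^sup>N a\<close>; in particular its monomials are divisible by \<open>x\<^sub>i\<^sup>N\<close>, and the factor can be removed
  within \<open>(g)\<close>.
\<close>
lemma dominated_multiple_of_bend:
  fixes g :: "('n::finite, 'k::field) mpoly" and a :: "('n, trop) mpoly"
  assumes \<nu>: "valuation \<nu>" and g: "homogeneous d g"
    and u0: "u0 \<in> Poly_Mapping.keys g" "Poly_Mapping.lookup u0 i = 0"
    and a: "homogeneous D a" "e \<in> Poly_Mapping.keys a" and "c \<noteq> 0"
    and bend: "(Poly_Mapping.single (Poly_Mapping.single i N) c * a,
      Poly_Mapping.single (Poly_Mapping.single i N) c * Poly_Mapping.update e 0 a)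
      \<in> bend_congruence (trop_ideal \<nu> (principal_ideal g))"
  obtains G where "g dvd G" "Poly_Mapping.lookup G e \<noteq> 0"
    "\<And>v. exp_degree v = D \<Longrightarrow> \<nu> (Poly_Mapping.lookup G v) * Poly_Mapping.lookup a e \<le>
      \<nu> (Poly_Mapping.lookup G e) * Poly_Mapping.lookup a v"
proof -
  let ?m = "Poly_Mapping.single i N"
  define h where "h = Poly_Mapping.single ?m c * a"
  define e' where "e' = ?m + e"
  define E where "E = {u :: 'n \<Rightarrow>\<^sub>0 nat. exp_degree u = N + D}"
  define L where "L = Poly_Mapping.lookup ` principal_ideal g"
  have bend': "(h, Poly_Mapping.update e' 0 h) \<in> bend_congruence (trop_ideal \<nu> (principal_ideal g))"
    using bend by (simp add: h_def e'_def monomial_times_update)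
  have "exp_degree e = D" using a by (simp add: homogeneous_def)
  then have E: "finite E" "e' \<in> E"
    by (simp_all add: E_def finite_exps_of_degree e'_def exp_degree_add exp_degree_single)
  have h_shift: "Poly_Mapping.lookup h (?m + v) = c * Poly_Mapping.lookup a v" for v
    by (simp add: h_def lookup_monomial_times)
  have he: "Poly_Mapping.lookup h e' \<noteq> 0"
    using a(2) \<open>c \<noteq> 0\<close> by (simp add: e'_def h_shift in_keys_iff)
  have closed: "(\<lambda>u. F u - r * G u) \<in> L" if "F \<in> L" "G \<in> L" for F G r
  proof -
    obtain P Q where PQ: "F = Poly_Mapping.lookup P" "G = Poly_Mapping.lookup Q" "g dvd P" "g dvd Q"
      using \<open>F \<in> L\<close> \<open>G \<in> L\<close> by (auto simp: L_def principal_ideal_def)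
    have "(\<lambda>u. F u - r * G u) = Poly_Mapping.lookup (P - cmult r Q)"
      by (simp add: PQ lookup_minus lookup_cmult fun_eq_iff)
    moreover have "g dvd P - cmult r Q"
      using PQ(3,4) by (simp add: cmult_def)
    ultimately show ?thesis by (auto simp: L_def principal_ideal_def)
  qed
  have no_dual: False
    if y: "\<forall>F\<in>L. (\<Sum>u\<in>E. y u * F u) = 0" "y e' \<noteq> 0"
      "\<forall>u\<in>E - {e'}. \<nu> (y u) * Poly_Mapping.lookup h u < \<nu> (y e') * Poly_Mapping.lookup h e'" for y
  proof -
    let ?top = "\<nu> (y e') * Poly_Mapping.lookup h e'"
    have top: "?top \<noteq> 0" using y(2) he by (simp add: valuation_eq_zero_iff[OF \<nu>])
    have "?top \<le> (\<Sum>u\<in>E. \<nu> (y u) * Poly_Mapping.lookup h u)"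
      by (rule trop_member_le_sum[OF E])
    also have "\<dots> = (\<Sum>u\<in>E. \<nu> (y u) * Poly_Mapping.lookup (Poly_Mapping.update e' 0 h) u)"
      using y(1) by (intro bend_congruence_sum_eq[OF \<nu> E(1) _ bend']) (auto simp: L_def)
    also have "\<dots> < ?top"
    proof (rule trop_sum_less[OF E(1) top])
      fix u assume "u \<in> E"
      then show "\<nu> (y u) * Poly_Mapping.lookup (Poly_Mapping.update e' 0 h) u < ?top"
        using y(3) top by (cases "u = e'") (auto simp: lookup_update trop_zero_less_iff)
    qed
    finally show False by simp
  qed
  have "\<exists>F\<in>L. F e' \<noteq> 0 \<and> (\<forall>u\<in>E. \<nu> (F u) * Poly_Mapping.lookup h e' \<le> \<nu> (F e') * Poly_Mapping.lookup h u)"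
    using nonarchimedean_farkas[OF \<nu> E, of "Poly_Mapping.lookup h" L, OF he closed] no_dual by blast
  then obtain P where P: "g dvd P" "Poly_Mapping.lookup P e' \<noteq> 0"
    "\<And>u. u \<in> E \<Longrightarrow> \<nu> (Poly_Mapping.lookup P u) * Poly_Mapping.lookup h e' \<le>
       \<nu> (Poly_Mapping.lookup P e') * Poly_Mapping.lookup h u"
    by (auto simp: L_def principal_ideal_def)
  obtain q where q: "P = g * q" using P(1) by (auto simp: dvd_def)
  define P' where "P' = hom_component (N + D) P"
  have P': "Poly_Mapping.lookup P' u = (if u \<in> E then Poly_Mapping.lookup P u else 0)" for u
    by (simp add: P'_def lookup_hom_component E_def)
  have "d \<le> N + D"
    using degree_le_of_lookup_mult[OF g, of q e'] P(2) E(2) by (simp add: q E_def)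
  then have "P' = g * hom_component (N + D - d) q"
    using hom_component_mult[OF g, of "N + D - d" q] by (simp add: P'_def q)
  then have "g dvd P'" by simp
  have "v \<in> range ((+) ?m)" if "v \<in> Poly_Mapping.keys P'" for v
  proof (rule ccontr)
    assume "v \<notin> range ((+) ?m)"
    then have "Poly_Mapping.lookup h v = 0" by (simp add: h_def lookup_monomial_times_eq_0)
    moreover have "v \<in> E" "Poly_Mapping.lookup P v \<noteq> 0"
      using that by (auto simp: in_keys_iff P' split: if_splits)
    ultimately show False using P(3)[of v] he by (simp add: valuation_eq_zero_iff[OF \<nu>])
  qed
  then obtain G where G: "P' = Poly_Mapping.single ?m 1 * G"
    using divide_var_power[of P' N i] by (auto simp: mem_range_add_single_iff)
  have G_shift: "Poly_Mapping.lookup G v = Poly_Mapping.lookup P (?m + v)" if "exp_degree v = D" for v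
  proof -
    have "Poly_Mapping.lookup G v = Poly_Mapping.lookup P' (?m + v)"
      by (simp add: G lookup_monomial_times)
    then show ?thesis using that by (simp add: P' E_def exp_degree_add exp_degree_single)
  qed
  show ?thesis
  proof (rule that)
    show "g dvd G"
      using \<open>g dvd P'\<close> unfolding G by (rule dvd_monomial_times_cancel[OF u0])
    show "Poly_Mapping.lookup G e \<noteq> 0"
      using P(2) \<open>exp_degree e = D\<close> by (simp add: G_shift e'_def)
    fix v :: "'n \<Rightarrow>\<^sub>0 nat" assume v: "exp_degree v = D"
    have "?m + v \<in> E" using v by (simp add: E_def exp_degree_add exp_degree_single)
    from P(3)[OF this] have "c * (\<nu> (Poly_Mapping.lookup G v) * Poly_Mapping.lookup a e) \<le>
        c * (\<nu> (Poly_Mapping.lookup G e) * Poly_Mapping.lookup a v)"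
      using v \<open>exp_degree e = D\<close> by (simp add: G_shift e'_def h_shift mult.left_commute)
    then show "\<nu> (Poly_Mapping.lookup G v) * Poly_Mapping.lookup a e \<le>
        \<nu> (Poly_Mapping.lookup G e) * Poly_Mapping.lookup a v"
      using \<open>c \<noteq> 0\<close> by (simp add: trop_mult_le_cancel)
  qed
qed

lemma Trop_eq_imp_dominated_multiple:
  fixes f g :: "('n::finite, 'k::field) mpoly"
  assumes \<nu>: "valuation \<nu>" and f: "homogeneous D f" and g: "homogeneous d g"
    and u0: "u0 \<in> Poly_Mapping.keys g" "Poly_Mapping.lookup u0 i = 0"
    and eq: "Trop \<nu> (principal_ideal f) = Trop \<nu> (principal_ideal g)"
    and e: "e \<in> Poly_Mapping.keys f"
  obtains G where "g dvd G" "Poly_Mapping.lookup G e \<noteq> 0"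
    "\<And>v. exp_degree v = D \<Longrightarrow>
      \<nu> (Poly_Mapping.lookup G v) * \<nu> (Poly_Mapping.lookup f e) \<le>
      \<nu> (Poly_Mapping.lookup G e) * \<nu> (Poly_Mapping.lookup f v)"
proof -
  let ?J = "trop_ideal \<nu> (principal_ideal f)" and ?a = "trop_poly \<nu> f"
  have J: "Poly_Mapping.single m 1 * h \<in> ?J" if "h \<in> ?J" for h m
    using that by (intro trop_ideal_monomial_times[OF \<nu>]) (simp_all add: principal_ideal_def)
  have hom: "homogeneous D ?a" "homogeneous D (Poly_Mapping.update e 0 ?a)"
    using f by (auto simp: homogeneous_def keys_trop_poly[OF \<nu>] in_keys_iff lookup_update
        lookup_trop_poly[OF \<nu>] valuation_eq_zero_iff[OF \<nu>] split: if_splits)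
  have "?a \<in> ?J" by (rule trop_poly_mem_trop_ideal) (simp add: principal_ideal_def)
  then have ab: "(?a, Poly_Mapping.update e 0 ?a) \<in> bend_congruence ?J"
    by (rule bend_mem_bend_congruence)
  have mult: "(q * a, q * b) \<in> bend_congruence ?J" if "(a, b) \<in> bend_congruence ?J" for q a b
    using J that by (rule bend_congruence_mult)
  obtain N c where c: "c \<noteq> 0"
    "(Poly_Mapping.single (Poly_Mapping.single i N) c * ?a,
      Poly_Mapping.single (Poly_Mapping.single i N) c * Poly_Mapping.update e 0 ?a)
      \<in> bend_congruence (trop_ideal \<nu> (principal_ideal g))"
    by (rule Proj_quotient_eq_imp_monomial_multiple[where i = i, OF mult
          eq[unfolded Trop_def] ab hom], assumption) (rule that)
  have e': "e \<in> Poly_Mapping.keys ?a" using e by (simp add: keys_trop_poly[OF \<nu>])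
  from dominated_multiple_of_bend[OF \<nu> g u0 hom(1) e' c] show ?thesis
    using that by (auto simp: lookup_trop_poly[OF \<nu>])
qed

lemma Trop_eq_imp_degree_le:
  fixes f g :: "('n::finite, 'k::field) mpoly"
  assumes \<nu>: "valuation \<nu>" and f: "homogeneous D f" "f \<noteq> 0" and g: "homogeneous d g"
    and u0: "u0 \<in> Poly_Mapping.keys g" "Poly_Mapping.lookup u0 i = 0"
    and eq: "Trop \<nu> (principal_ideal f) = Trop \<nu> (principal_ideal g)"
  shows "d \<le> D"
proof -
  obtain e where e: "e \<in> Poly_Mapping.keys f" using f(2) by fastforce
  obtain G where "g dvd G" "Poly_Mapping.lookup G e \<noteq> 0"
    by (rule Trop_eq_imp_dominated_multiple[OF \<nu> f(1) g u0 eq e]) (rule that)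
  then have "d \<le> exp_degree e"
    using degree_le_of_lookup_mult[OF g] by (auto simp: dvd_def)
  then show ?thesis using e f(1) by (simp add: homogeneous_def)
qed

text \<open>In equal degrees the dominated multiple of \<open>g\<close> is \<open>r g\<close> with a constant \<open>r\<close>, which cancels.\<close>
lemma Trop_eq_imp_coeff_le:
  fixes f g :: "('n::finite, 'k::field) mpoly"
  assumes \<nu>: "valuation \<nu>" and f: "homogeneous d f" and g: "homogeneous d g"
    and u0: "u0 \<in> Poly_Mapping.keys g" "Poly_Mapping.lookup u0 i = 0"
    and eq: "Trop \<nu> (principal_ideal f) = Trop \<nu> (principal_ideal g)"
    and e: "e \<in> Poly_Mapping.keys f"
  shows "e \<in> Poly_Mapping.keys g"
    and "\<nu> (Poly_Mapping.lookup g v) * \<nu> (Poly_Mapping.lookup f e) \<le>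
      \<nu> (Poly_Mapping.lookup g e) * \<nu> (Poly_Mapping.lookup f v)"
proof -
  obtain G where G: "g dvd G" "Poly_Mapping.lookup G e \<noteq> 0"
    "\<And>v. exp_degree v = d \<Longrightarrow>
      \<nu> (Poly_Mapping.lookup G v) * \<nu> (Poly_Mapping.lookup f e) \<le>
      \<nu> (Poly_Mapping.lookup G e) * \<nu> (Poly_Mapping.lookup f v)"
    by (rule Trop_eq_imp_dominated_multiple[OF \<nu> f g u0 eq e]) (rule that)
  obtain q where q: "G = g * q" using G(1) by (auto simp: dvd_def)
  define r where "r = Poly_Mapping.lookup q 0"
  have "hom_component 0 q = Poly_Mapping.single 0 r"
    by (rule poly_mapping_eqI)
      (auto simp: lookup_hom_component exp_degree_eq_0_iff lookup_single when_def r_def)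
  then have "hom_component d G = Poly_Mapping.single 0 r * g"
    using hom_component_mult[OF g, of 0 q] by (simp add: q mult.commute)
  then have coeff: "Poly_Mapping.lookup G v = r * Poly_Mapping.lookup g v" if "exp_degree v = d" for v
    using that lookup_monomial_times[of 0 r g v] lookup_hom_component[of d G v] by simp
  have "exp_degree e = d" using e f by (simp add: homogeneous_def)
  note e_coeff = coeff[OF this]
  have "r \<noteq> 0" using G(2) e_coeff by auto
  show "e \<in> Poly_Mapping.keys g" using G(2) e_coeff by (simp add: in_keys_iff)
  show "\<nu> (Poly_Mapping.lookup g v) * \<nu> (Poly_Mapping.lookup f e) \<le>
      \<nu> (Poly_Mapping.lookup g e) * \<nu> (Poly_Mapping.lookup f v)"
  proof (cases "exp_degree v = d")
    case True
    have "\<nu> r * (\<nu> (Poly_Mapping.lookup g v) * \<nu> (Poly_Mapping.lookup f e)) \<le>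
        \<nu> r * (\<nu> (Poly_Mapping.lookup g e) * \<nu> (Poly_Mapping.lookup f v))"
      using G(3)[OF True] by (simp add: coeff[OF True] e_coeff valuation_mult[OF \<nu>] mult.assoc)
    then show ?thesis
      using \<open>r \<noteq> 0\<close> by (simp add: trop_mult_le_cancel valuation_eq_zero_iff[OF \<nu>])
  next
    case False
    then show ?thesis by (simp add: homogeneousD[OF g] valuation_zero[OF \<nu>])
  qed
qed

text \<open>
  Both inequalities are used at the same exponent \<open>u\<close> of \<open>f\<close>; it is an exponent of \<open>g\<close> as well, so the
  roles can be exchanged there, and the ratio at any \<open>w\<close> equals the ratio at \<open>u\<close>.
\<close>
lemma Trop_eq_imp_proportional:
  fixes f g :: "('n::finite, 'k::field) mpoly"
  assumes \<nu>: "valuation \<nu>" and f: "homogeneous D f" and g: "homogeneous d g"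
    and u: "u \<in> Poly_Mapping.keys f" "Poly_Mapping.lookup u i = 0"
    and v: "v \<in> Poly_Mapping.keys g" "Poly_Mapping.lookup v i = 0"
    and eq: "Trop \<nu> (principal_ideal f) = Trop \<nu> (principal_ideal g)"
  obtains r where "\<And>w. Poly_Mapping.lookup (trop_poly \<nu> g) w = Fin r * Poly_Mapping.lookup (trop_poly \<nu> f) w"
proof -
  have "f \<noteq> 0" "g \<noteq> 0" using u v by auto
  then have "D = d"
    using Trop_eq_imp_degree_le[OF \<nu> f _ g v eq] Trop_eq_imp_degree_le[OF \<nu> g _ f u eq[symmetric]] by simp
  note f = f[unfolded this]
  note le = Trop_eq_imp_coeff_le[OF \<nu> f g v eq u(1)]
  note ge = Trop_eq_imp_coeff_le[OF \<nu> g f u eq[symmetric] le(1)]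
  have ratio: "\<nu> (Poly_Mapping.lookup g w) * \<nu> (Poly_Mapping.lookup f u) =
      \<nu> (Poly_Mapping.lookup g u) * \<nu> (Poly_Mapping.lookup f w)" for w
    using le(2)[of w] ge(2)[of w] by (simp add: mult.commute)
  have "\<nu> (Poly_Mapping.lookup f u) \<noteq> 0" "\<nu> (Poly_Mapping.lookup g u) \<noteq> 0"
    using u(1) le(1) by (simp_all add: valuation_eq_zero_iff[OF \<nu>] in_keys_iff)
  then obtain x y where xy: "\<nu> (Poly_Mapping.lookup f u) = Fin x" "\<nu> (Poly_Mapping.lookup g u) = Fin y"
    by (cases "\<nu> (Poly_Mapping.lookup f u)"; cases "\<nu> (Poly_Mapping.lookup g u)") (auto simp: zero_trop_def)
  have "\<nu> (Poly_Mapping.lookup g w) = Fin (y - x) * \<nu> (Poly_Mapping.lookup f w)" for w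
    using ratio[of w] unfolding xy
    by (cases "\<nu> (Poly_Mapping.lookup g w)"; cases "\<nu> (Poly_Mapping.lookup f w)") auto
  then show ?thesis using that by (simp add: lookup_trop_poly[OF \<nu>])
qed

lemma max_exps_scale:
  assumes "\<And>w. Poly_Mapping.lookup h' w = Fin r * Poly_Mapping.lookup h w"
  shows "max_exps h' = max_exps h"
proof (rule ext)
  fix w
  have r: "Fin r \<noteq> 0" by (simp add: zero_trop_def)
  have "Poly_Mapping.keys h' = Poly_Mapping.keys h"
    using r by (auto simp: in_keys_iff assms)
  moreover have "term_at h' u w = Fin r * term_at h u w" for u
    by (simp add: term_at_def assms mult.assoc)
  ultimately show "max_exps h' w = max_exps h w"
    by (simp add: max_exps_def trop_mult_le_cancel[OF r])
qed

theorem corollary7p2p2: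
  fixes \<nu> :: "'k::alg_closed_field \<Rightarrow> trop"
    and f g :: "('n::finite, 'k) mpoly"
  assumes "valuation \<nu>"
    and "irreducible_hypersurface f"
    and "irreducible_hypersurface g"
    and "\<And>i. \<not> zeros (principal_ideal f) \<subseteq> zeros {var i}"
    and "\<And>i. \<not> zeros (principal_ideal g) \<subseteq> zeros {var i}"
    and "Trop \<nu> (principal_ideal f) = Trop \<nu> (principal_ideal g)"
  shows "tropical_hypersurface (trop_poly \<nu> f) = tropical_hypersurface (trop_poly \<nu> g) \<and>
    facets (trop_poly \<nu> f) = facets (trop_poly \<nu> g) \<and>
    (\<forall>F\<in>facets (trop_poly \<nu> f). \<forall>w\<in>F.
       multiplicity_at (trop_poly \<nu> f) w = multiplicity_at (trop_poly \<nu> g) w)"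
proof -
  obtain D d where hom: "homogeneous D f" "homogeneous d g"
    using assms(2,3) by (auto simp: irreducible_hypersurface_def)
  (* Any chart of projective space determines the tropical polynomial. *)
  fix i :: 'n
  obtain u where u: "u \<in> Poly_Mapping.keys f" "Poly_Mapping.lookup u i = 0"
    by (rule irreducible_hypersurface_not_var_dvd[OF assms(2,4)]) (rule that)
  obtain v where v: "v \<in> Poly_Mapping.keys g" "Poly_Mapping.lookup v i = 0"
    by (rule irreducible_hypersurface_not_var_dvd[OF assms(3,5)]) (rule that)
  obtain r where "\<And>w. Poly_Mapping.lookup (trop_poly \<nu> g) w = Fin r * Poly_Mapping.lookup (trop_poly \<nu> f) w"
    by (rule Trop_eq_imp_proportional[OF assms(1) hom u v assms(6)]) (rule that)
  then have "max_exps (trop_poly \<nu> g) = max_exps (trop_poly \<nu> f)" by (rule max_exps_scale)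
  then show ?thesis
    by (simp add: tropical_hypersurface_def facets_def cell_def multiplicity_at_def)
qed

end
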